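(* Let $X$ be a Banach space, let $h>0$ be the time step, and let $A:D(A)\subset X\to X$ be a densely defined, closed, linear (possibly unbounded) operator that generates a strongly continuous $C_0$-semigroup $e^{tA}$ on $X$. Let $B(s)\in\mathfrak{B}(X)$ for each $s\in[0,h]$, with $B\in C^2([0,h],\mathfrak{B}(X))$, and let $u\in C^1([0,h],X)$ be the solution of $$u'(t)=[A+B(t)]u(t),\qquad u(0)=u_0.$$ Assume that $\|[[B(s),A],A]e^{sA}u_0\|$ is well defined and bounded for $s\in[0,h]$, and that the commutator $[B(s),A]$ is bounded for each $s\in[0,h]$. For $\tau\in[0,1]$ let $$\mathcal{D}(h,\tau):=e^{h(1-\tau)A}\,e^{hB(h\tau)+\frac{h^2(1-2\tau)}{2}\mathcal{C}(h\tau)}\,e^{h\tau A},\qquad \mathcal{C}(t):=[B(t),A]+B'(t).$$ Then $\mathcal{D}(h,\tau)$ has third (local) order of accuracy: $$\|u(h)-\mathcal{D}(h,\tau)u_0\|\le h^3\,C\max_{r,s\in[0,h]}\Big\{\big\|[B(s),A]e^{rA}u_0\big\|,\ \big\|[B'(s),A]e^{sA}u_0\big\|,\ \big\|[[B(s),A],A]e^{sA}u_0\big\|,\ \|u_0\|\Big\},$$ where the constant $C$ depends on $\tau$, $\|B\|_Y$ and $\|B''\|_Y$.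
   Context: $\mathfrak{B}(X)$ is the space of bounded linear operators on $X$; $\|\cdot\|$ denotes the norm of $X$ and the induced operator norm. For a function $v$ on $[0,h]$ (with values in $X$ or in $\mathfrak{B}(X)$), $\|v\|_Y:=\max_{s\in[0,h]}\|v(s)\|$. Primes on $B$ denote derivatives with respect to time, and $[P,Q]=PQ-QP$ is the commutator.
   Formalization: C may also depend on ‖B'‖_Y, sup over s of ‖[B(s),A]‖ (assumed finite), sup of ‖e^{sA}‖ on [0,h] and an arbitrary upper bound H for h; with only τ, ‖B‖_Y, ‖B''‖_Y the claim fails. [B'(s),A]e^{sA}u0 is assumed defined and bounded. *)

theory Defs
  imports "HOL-Analysis.Analysis"
begin

text \<open>Bounded operators on the Banach space are elements of \<open>'a \<Rightarrow>\<^sub>L 'a\<close>, with composition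
  \<open>o\<^sub>L\<close>.  An unbounded operator is a pair of a domain \<open>D\<close> and a total function \<open>A\<close>, of which only
  the values on \<open>D\<close> are meaningful.  Scalars are real, which includes complex Banach spaces by
  restriction of scalars.\<close>

definition densely_defined_closed_operator ::
    "'a::real_normed_vector set \<Rightarrow> ('a \<Rightarrow> 'a) \<Rightarrow> bool" where
  "densely_defined_closed_operator D A \<longleftrightarrow>
     subspace D \<and> closure D = UNIV \<and>
     (\<forall>x\<in>D. \<forall>y\<in>D. A (x + y) = A x + A y) \<and>
     (\<forall>c. \<forall>x\<in>D. A (c *\<^sub>R x) = c *\<^sub>R A x) \<and>
     closed {(x, A x) | x. x \<in> D}"

definition C0_semigroup :: "(real \<Rightarrow> 'a::real_normed_vector \<Rightarrow>\<^sub>L 'a) \<Rightarrow> bool" where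
  "C0_semigroup S \<longleftrightarrow>
     S 0 = id_blinfun \<and>
     (\<forall>s\<ge>0. \<forall>t\<ge>0. S (s + t) = S s o\<^sub>L S t) \<and>
     (\<forall>x. ((\<lambda>t. S t x) \<longlongrightarrow> x) (at_right 0))"

text \<open>\<open>(D, A)\<close> is the generator of \<open>S\<close>, that is, \<open>S t\<close> is what is written \<open>e\<close> to the power \<open>tA\<close>.\<close>

definition generates ::
    "'a::real_normed_vector set \<Rightarrow> ('a \<Rightarrow> 'a) \<Rightarrow> (real \<Rightarrow> 'a \<Rightarrow>\<^sub>L 'a) \<Rightarrow> bool" where
  "generates D A S \<longleftrightarrow>
     C0_semigroup S \<and>
     D = {x. \<exists>y. ((\<lambda>t. (S t x - x) /\<^sub>R t) \<longlongrightarrow> y) (at_right 0)} \<and>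
     (\<forall>x\<in>D. ((\<lambda>t. (S t x - x) /\<^sub>R t) \<longlongrightarrow> A x) (at_right 0))"

text \<open>The library's \<open>exp\<close> does not apply: \<open>'a \<Rightarrow>\<^sub>L 'a\<close> is no instance of its algebra class.\<close>

definition blinfun_exp :: "('a::real_normed_vector \<Rightarrow>\<^sub>L 'a) \<Rightarrow> ('a \<Rightarrow>\<^sub>L 'a)" where
  "blinfun_exp T = (\<Sum>n. (((o\<^sub>L) T ^^ n) id_blinfun) /\<^sub>R fact n)"

text \<open>The commutator \<open>[P, A] = P A - A P\<close> of a bounded \<open>P\<close> with \<open>(D, A)\<close>; its value at \<open>x\<close> is well
  defined precisely when \<open>x \<in> commutator_domain D P\<close>.\<close>

definition commutator_domain ::
    "'a::real_normed_vector set \<Rightarrow> ('a \<Rightarrow>\<^sub>L 'a) \<Rightarrow> 'a set" where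
  "commutator_domain D P = {x \<in> D. P x \<in> D}"

definition commutator ::
    "('a::real_normed_vector \<Rightarrow> 'a) \<Rightarrow> ('a \<Rightarrow>\<^sub>L 'a) \<Rightarrow> 'a \<Rightarrow> 'a" where
  "commutator A P x = P (A x) - A (P x)"

definition bounded_commutator ::
    "'a::real_normed_vector set \<Rightarrow> ('a \<Rightarrow> 'a) \<Rightarrow> ('a \<Rightarrow>\<^sub>L 'a) \<Rightarrow> bool" where
  "bounded_commutator D A P \<longleftrightarrow>
     commutator_domain D P = D \<and>
     (\<exists>k. \<forall>x\<in>D. norm (commutator A P x) \<le> k * norm x)"

text \<open>A bounded commutator is identified with its continuous extension from the dense subspace \<open>D\<close>
  to the whole Banach space, which exists uniquely.\<close>

definition commutator_ext ::
    "'a::real_normed_vector set \<Rightarrow> ('a \<Rightarrow> 'a) \<Rightarrow> ('a \<Rightarrow>\<^sub>L 'a) \<Rightarrow> ('a \<Rightarrow>\<^sub>L 'a)" where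
  "commutator_ext D A P = (THE K. \<forall>x\<in>D. blinfun_apply K x = commutator A P x)"

text \<open>Supremum instead of maximum, since it is also applied to functions that need not be norm
  continuous; the two agree for continuous \<open>v\<close>.\<close>

definition Y_norm :: "real \<Rightarrow> (real \<Rightarrow> 'b::real_normed_vector) \<Rightarrow> real" where
  "Y_norm h v = (SUP s\<in>{0..h}. norm (v s))"

text \<open>One-sided derivatives at the end points, all in the operator norm.\<close>

definition C2_on :: "real \<Rightarrow> (real \<Rightarrow> 'b::real_normed_vector) \<Rightarrow> (real \<Rightarrow> 'b) \<Rightarrow> (real \<Rightarrow> 'b) \<Rightarrow> bool" where
  "C2_on h B B' B'' \<longleftrightarrow>
     (\<forall>s\<in>{0..h}. (B has_vector_derivative B' s) (at s within {0..h})) \<and>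
     (\<forall>s\<in>{0..h}. (B' has_vector_derivative B'' s) (at s within {0..h})) \<and>
     continuous_on {0..h} B''"

text \<open>A continuously differentiable solution of \<open>u' = (A + B) u\<close>; the equation at \<open>t = 0\<close> forces
  the initial value to lie in \<open>D\<close>.\<close>

definition C1_solution ::
    "'a::real_normed_vector set \<Rightarrow> ('a \<Rightarrow> 'a) \<Rightarrow> (real \<Rightarrow> 'a \<Rightarrow>\<^sub>L 'a) \<Rightarrow> real \<Rightarrow> 'a \<Rightarrow> (real \<Rightarrow> 'a) \<Rightarrow> bool"
  where
  "C1_solution D A B h u0 u \<longleftrightarrow>
     u 0 = u0 \<and>
     (\<forall>t\<in>{0..h}. u t \<in> D \<and>
        (u has_vector_derivative (A (u t) + B t (u t))) (at t within {0..h})) \<and>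
     continuous_on {0..h} (\<lambda>t. A (u t) + B t (u t))"

definition C_op ::
    "'a::real_normed_vector set \<Rightarrow> ('a \<Rightarrow> 'a) \<Rightarrow> (real \<Rightarrow> 'a \<Rightarrow>\<^sub>L 'a) \<Rightarrow> (real \<Rightarrow> 'a \<Rightarrow>\<^sub>L 'a) \<Rightarrow>
     real \<Rightarrow> ('a \<Rightarrow>\<^sub>L 'a)" where
  "C_op D A B B' t = commutator_ext D A (B t) + B' t"

definition D_op ::
    "'a::real_normed_vector set \<Rightarrow> ('a \<Rightarrow> 'a) \<Rightarrow> (real \<Rightarrow> 'a \<Rightarrow>\<^sub>L 'a) \<Rightarrow> (real \<Rightarrow> 'a \<Rightarrow>\<^sub>L 'a) \<Rightarrow>
     (real \<Rightarrow> 'a \<Rightarrow>\<^sub>L 'a) \<Rightarrow> real \<Rightarrow> real \<Rightarrow> ('a \<Rightarrow>\<^sub>L 'a)" where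
  "D_op D A S B B' h \<tau> =
     S (h * (1 - \<tau>)) o\<^sub>L
     blinfun_exp (h *\<^sub>R B (h * \<tau>) + (h\<^sup>2 * (1 - 2 * \<tau>) / 2) *\<^sub>R C_op D A B B' (h * \<tau>)) o\<^sub>L
     S (h * \<tau>)"

definition error_max ::
    "'a::real_normed_vector set \<Rightarrow> ('a \<Rightarrow> 'a) \<Rightarrow> (real \<Rightarrow> 'a \<Rightarrow>\<^sub>L 'a) \<Rightarrow> (real \<Rightarrow> 'a \<Rightarrow>\<^sub>L 'a) \<Rightarrow>
     (real \<Rightarrow> 'a \<Rightarrow>\<^sub>L 'a) \<Rightarrow> real \<Rightarrow> 'a \<Rightarrow> real" where
  "error_max D A S B B' h u0 =
     (SUP (r, s) \<in> {0..h} \<times> {0..h}.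
        Max {norm (commutator A (B s) (S r u0)),
             norm (commutator A (B' s) (S s u0)),
             norm (commutator A (commutator_ext D A (B s)) (S s u0)),
             norm u0})"

end

theory Submission
  imports Defs
begin

text \<open>
  The solution satisfies \<open>(S (h - s) (u s))' = S (h - s) (B s (u s))\<close>, so it suffices to expand the
  right-hand side to first order around \<open>\<sigma> = h * \<tau>\<close> with an error \<open>O(h\<^sup>2)\<close>. Since
  \<open>u s = S s u0 + s *\<^sub>R B s (S s u0) + O(h\<^sup>2)\<close>, it equals, up to such an error,
  \<open>f s + s *\<^sub>R S (h - s) (B s (B s (S s u0)))\<close> with \<open>f s = S (h - s) (B s (S s u0))\<close>. As \<open>[B, A]\<close> is
  bounded, the last term is Lipschitz, and \<open>f\<close> has the derivative \<open>f' s = S (h - s) (\<C> s (S s u0))\<close>;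
  the double commutator makes \<open>f'\<close> Lipschitz. Integrating the expansion over \<open>{0..h}\<close> yields exactly
  the terms of order at most two of the exponential in the splitting scheme.
\<close>

text \<open>The weight \<open>1 - 2 * \<tau>\<close> in the scheme has its origin in the integral of
  \<open>s - \<sigma>\<close> over \<open>{0..h}\<close>, which is
  \<open>h\<^sup>2 / 2 - h * \<sigma>\<close>; it multiplies \<open>f' \<sigma>\<close>, in which
  \<open>C_op\<close> appears. The obstacle is the Lipschitz bound for \<open>f'\<close>. Formally
  its derivative is \<open>S (h - s) (W s)\<close>, but nothing is assumed about how the commutator
  of \<open>B s\<close> with \<open>A\<close> varies with \<open>s\<close> beyond a uniform bound,
  and the double commutator is controlled only along the orbit \<open>S s u0\<close>. So no second
  derivative of \<open>f\<close> is formed: averages of \<open>f'\<close> over short pieces of the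
  semigroup are differentiated from the right, a mean value inequality for right derivatives is
  applied to them, and the length of averaging tends to 0 in a bound that does not depend on it.
  Every estimate also needs a norm bound for \<open>S\<close> on a compact interval. Strong
  continuity alone gives only bounds on single orbits, which is why uniform boundedness
  enters.\<close>

section \<open>Mean value inequalities and uniform boundedness\<close>

text \<open>Right derivatives suffice because the largest point up to \<open>b\<close> at which the
  bound measured from \<open>a\<close> holds could always be passed by a small step to the right.
  The averaged \<open>f'\<close> will be differentiated only in this sense.\<close>

lemma right_derivative_bound:
  fixes f :: "real \<Rightarrow> 'a::real_normed_vector"
  assumes "a \<le> b" and cont: "continuous_on {a..b} f"
    and deriv: "\<And>s. a \<le> s \<Longrightarrow> s < b \<Longrightarrow>
      ((\<lambda>d. (f (s + d) - f s) /\<^sub>R d) \<longlongrightarrow> f' s) (at_right 0)"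
    and bound: "\<And>s. a \<le> s \<Longrightarrow> s < b \<Longrightarrow> norm (f' s) \<le> L"
  shows "norm (f b - f a) \<le> L * (b - a)"
proof -
  \<comment> \<open>The slack \<open>e\<close> makes the norm of the derivative strictly smaller
    than the slope, so that difference quotients over short steps inherit the inequality.\<close>
  have *: "norm (f b - f a) \<le> (L + e) * (b - a)" if "e > 0" for e
  proof (rule ccontr)
    assume neg: "\<not> norm (f b - f a) \<le> (L + e) * (b - a)"
    define g where "g x = norm (f x - f a) - (L + e) * (x - a)" for x
    define Z where "Z = {x \<in> {a..b}. g x \<le> 0}"
    have "continuous_on {a..b} g"
      unfolding g_def by (intro continuous_intros cont)
    then have "closedin (top_of_set {a..b}) ({a..b} \<inter> g -` {..0})"
      by (intro continuous_closedin_preimage) auto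
    then have "closed ({a..b} \<inter> g -` {..0})"
      by (auto intro: closedin_closed_trans)
    moreover have "Z = {a..b} \<inter> g -` {..0}" by (auto simp: Z_def)
    ultimately have "compact Z"
      by (metis Int_lower1 bounded_closed_interval bounded_subset compact_eq_bounded_closed)
    moreover have "a \<in> Z" using \<open>a \<le> b\<close> by (simp add: Z_def g_def)
    ultimately obtain c where c: "c \<in> Z" "\<And>x. x \<in> Z \<Longrightarrow> x \<le> c"
      using compact_attains_sup[of Z] by blast
    have "b \<notin> Z" using neg by (simp add: Z_def g_def)
    with c(1) have cab: "a \<le> c" "c < b" by (auto simp: Z_def less_le)
    have "((\<lambda>d. norm ((f (c + d) - f c) /\<^sub>R d)) \<longlongrightarrow> norm (f' c)) (at_right 0)"
      by (intro tendsto_norm deriv cab)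
    moreover have "norm (f' c) < L + e" using bound[OF cab] \<open>e > 0\<close> by simp
    ultimately have "\<forall>\<^sub>F d in at_right 0. norm ((f (c + d) - f c) /\<^sub>R d) < L + e"
      by (rule order_tendstoD)
    moreover have "\<forall>\<^sub>F d in at_right 0. d < b - c"
      using cab by (intro order_tendstoD(2)[OF tendsto_ident_at]) simp
    moreover have "\<forall>\<^sub>F d in at_right 0. 0 < (d::real)"
      by (rule eventually_at_right_less)
    ultimately have "\<forall>\<^sub>F d in at_right (0::real). False"
    proof eventually_elim
      case (elim d)
      then have "norm (f (c + d) - f c) \<le> (L + e) * d"
        by (simp add: divide_simps mult.commute)
      moreover have "norm (f (c + d) - f a) \<le> norm (f (c + d) - f c) + norm (f c - f a)"
        by (metis diff_add_cancel add_diff_eq norm_triangle_ineq)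
      moreover have "g c \<le> 0" using c(1) by (simp add: Z_def)
      ultimately have "g (c + d) \<le> 0" by (simp add: g_def algebra_simps)
      then have "c + d \<in> Z" using elim cab by (simp add: Z_def)
      with c(2)[of "c + d"] elim show ?case by simp
    qed
    then show False by simp
  qed
  have "((\<lambda>e. (L + e) * (b - a)) \<longlongrightarrow> (L + 0) * (b - a)) (at_right 0)"
    by (intro tendsto_intros)
  moreover have "\<forall>\<^sub>F e in at_right 0. norm (f b - f a) \<le> (L + e) * (b - a)"
    using * by (auto simp: eventually_at_filter)
  ultimately show ?thesis
    using tendsto_lowerbound[of "\<lambda>e. (L + e) * (b - a)" "L * (b - a)" "at_right 0"] by simp
qed

lemma vector_derivative_bound:
  fixes f :: "real \<Rightarrow> 'a::real_normed_vector"
  assumes deriv: "\<And>s. s \<in> {a..b} \<Longrightarrow> (f has_vector_derivative f' s) (at s within {a..b})"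
    and bound: "\<And>s. s \<in> {a..b} \<Longrightarrow> norm (f' s) \<le> L"
    and "x \<in> {a..b}" "y \<in> {a..b}"
  shows "norm (f x - f y) \<le> L * \<bar>x - y\<bar>"
proof -
  have "norm (f x - f y) \<le> L * norm (x - y)"
  proof (rule differentiable_bound[where S = "{a..b}" and f' = "\<lambda>s d. d *\<^sub>R f' s"])
    show "(f has_derivative (\<lambda>d. d *\<^sub>R f' s)) (at s within {a..b})" if "s \<in> {a..b}" for s
      using deriv[OF that] by (simp add: has_vector_derivative_def)
    show "onorm (\<lambda>d. d *\<^sub>R f' s) \<le> L" if "s \<in> {a..b}" for s
      using bound[OF that] by (simp add: onorm_scaleR_left[OF bounded_linear_ident] onorm_id)
  qed (use assms in auto)
  then show ?thesis by simp
qed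

text \<open>The condensation argument of Sokal: the points \<open>x n\<close> move by \<open>1 / 3 ^ n\<close> while the operator
  norms grow faster, and the limit point contradicts pointwise boundedness.\<close>

lemma uniform_boundedness:
  fixes T :: "nat \<Rightarrow> 'a::banach \<Rightarrow>\<^sub>L 'b::real_normed_vector"
  assumes pointwise: "\<And>x. bdd_above (range (\<lambda>n. norm (T n x)))"
  shows "bdd_above (range (\<lambda>n. norm (T n)))"
proof (rule ccontr)
  assume unb: "\<not> bdd_above (range (\<lambda>n. norm (T n)))"
  have "\<exists>m. norm (T m) > 4 ^ n" for n
    using unb by (force simp: bdd_above_def not_le)
  then obtain m where m: "norm (T (m n)) > 4 ^ n" for n by metis
  define R where "R n = T (m n)" for n
  have R: "norm (R n) > 4 ^ n" for n by (simp add: R_def m)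
  have step: "\<exists>y. norm (y - x) \<le> (1/3) ^ n \<and> (2/3) * (1/3) ^ n * norm (R n) \<le> norm (R n y)" for x n
  proof -
    have "\<exists>z. (2/3) * norm (R n) * norm z < norm (R n z)"
    proof (rule ccontr)
      assume "\<not> ?thesis"
      then have "norm (R n) \<le> (2/3) * norm (R n)"
        by (intro norm_blinfun_bound) (auto simp: not_less)
      moreover have "norm (R n) > 0" using R[of n] by (meson less_trans zero_less_numeral zero_less_power)
      ultimately show False by simp
    qed
    then obtain z where z: "(2/3) * norm (R n) * norm z < norm (R n z)" by blast
    then have "z \<noteq> 0" by auto
    define w where "w = ((1/3) ^ n / norm z) *\<^sub>R z"
    have nw: "norm w = (1/3) ^ n" using \<open>z \<noteq> 0\<close> by (simp add: w_def)
    have "(2/3) * norm (R n) * norm z * ((1/3) ^ n / norm z) \<le> norm (R n z) * ((1/3) ^ n / norm z)"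
      using z by (intro mult_right_mono) auto
    then have Rw: "(2/3) * (1/3) ^ n * norm (R n) \<le> norm (R n w)"
      using \<open>z \<noteq> 0\<close> by (simp add: w_def blinfun.scaleR_right field_simps)
    \<comment> \<open>Twice \<open>w\<close> is the difference of \<open>x + w\<close> and
      \<open>x - w\<close>, so at least one of these two points has an image as large as that of
      \<open>w\<close>. Both lie at distance \<open>norm w\<close> from \<open>x\<close>.\<close>
    have "norm (R n w) \<le> max (norm (R n (x + w))) (norm (R n (x - w)))"
    proof -
      have "2 *\<^sub>R R n w = R n (x + w) - R n (x - w)"
        by (simp add: blinfun.add_right blinfun.diff_right scaleR_2)
      then have "2 * norm (R n w) \<le> norm (R n (x + w)) + norm (R n (x - w))"
        by (metis norm_scaleR abs_numeral norm_triangle_ineq4)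
      then show ?thesis by linarith
    qed
    then have "(2/3) * (1/3) ^ n * norm (R n) \<le> norm (R n (x + w)) \<or>
        (2/3) * (1/3) ^ n * norm (R n) \<le> norm (R n (x - w))"
      using Rw by linarith
    then show ?thesis
      using nw by (elim disjE) (rule exI[of _ "x + w"] exI[of _ "x - w"]; simp)+
  qed
  then obtain F where F: "norm (F x n - x) \<le> (1/3) ^ n"
    "(2/3) * (1/3) ^ n * norm (R n) \<le> norm (R n (F x n))" for x n
    by metis
  define x where "x = rec_nat (F 0 0) (\<lambda>n y. F y (Suc n))"
  have x_Suc: "x (Suc n) = F (x n) (Suc n)" for n by (simp add: x_def)
  have dx: "norm (x (Suc n) - x n) \<le> (1/3) ^ Suc n" for n
    unfolding x_Suc by (rule F)
  have Rx: "(2/3) * (1/3) ^ n * norm (R n) \<le> norm (R n (x n))" for n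
  proof (cases n)
    case 0
    then show ?thesis using F(2)[of 0 0] by (simp add: x_def)
  next
    case (Suc k)
    then show ?thesis using F(2)[of "Suc k" "x k"] by (simp add: x_Suc)
  qed
  have tele: "norm (x (n + k) - x n) \<le> (1/2) * (1/3) ^ n - (1/2) * (1/3) ^ (n + k)" for n k
  proof (induction k)
    case (Suc k)
    have "norm (x (n + Suc k) - x n) \<le> norm (x (Suc (n + k)) - x (n + k)) + norm (x (n + k) - x n)"
      using norm_triangle_ineq[of "x (Suc (n + k)) - x (n + k)" "x (n + k) - x n"] by simp
    with Suc dx[of "n + k"] show ?case by simp
  qed simp
  have "Cauchy x"
  proof (rule metric_CauchyI)
    fix e :: real assume "e > 0"
    then obtain N where N: "(1/3::real) ^ N < e"
      using real_arch_pow_inv[of e "1/3"] by auto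
    have *: "norm (x k - x N) < e / 2" if "k \<ge> N" for k
    proof -
      have "norm (x k - x N) \<le> (1/2) * (1/3) ^ N - (1/2) * (1/3) ^ k"
        using tele[of N "k - N"] that by simp
      also have "\<dots> < e / 2"
      proof -
        have "(0::real) < (1/3) ^ k" by simp
        with N show ?thesis by linarith
      qed
      finally show ?thesis .
    qed
    show "\<exists>M. \<forall>i\<ge>M. \<forall>j\<ge>M. dist (x i) (x j) < e"
    proof (intro exI allI impI)
      fix i j assume "i \<ge> N" "j \<ge> N"
      then have "dist (x i) (x N) < e / 2" "dist (x j) (x N) < e / 2"
        using * by (auto simp: dist_norm)
      then show "dist (x i) (x j) < e" by (rule dist_triangle_half_l)
    qed
  qed
  then obtain l where l: "x \<longlonglongrightarrow> l"
    using Cauchy_convergent convergent_def by blast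
  have xl: "norm (l - x n) \<le> (1/2) * (1/3) ^ n" for n
  proof (rule LIMSEQ_le_const2)
    show "(\<lambda>k. norm (x (k + n) - x n)) \<longlonglongrightarrow> norm (l - x n)"
      by (intro tendsto_intros LIMSEQ_ignore_initial_segment l)
    show "\<exists>N. \<forall>k\<ge>N. norm (x (k + n) - x n) \<le> (1/2) * (1/3) ^ n"
    proof (intro exI allI impI)
      fix k
      have "(0::real) < (1/3) ^ (n + k)" by simp
      with tele[of n k] show "norm (x (k + n) - x n) \<le> (1/2) * (1/3) ^ n"
        unfolding add.commute[of k n] by linarith
    qed
  qed
  \<comment> \<open>The moves after step \<open>n\<close> add up to at most \<open>1/2\<close> of
    \<open>(1/3) ^ n\<close>, less than the \<open>2/3\<close> gained at that step. The difference
    \<open>1/6\<close> survives, and the norms, which exceed \<open>4 ^ n\<close>, outgrow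
    \<open>3 ^ n\<close>.\<close>
  have big: "norm (R n l) \<ge> (1/6) * (4/3) ^ n" for n
  proof -
    have "norm (R n (l - x n)) \<le> norm (R n) * ((1/2) * (1/3) ^ n)"
      using norm_blinfun[of "R n" "l - x n"] xl[of n] mult_left_mono[OF xl norm_ge_zero]
      by (meson order_trans)
    moreover have "norm (R n (x n)) \<le> norm (R n l) + norm (R n (l - x n))"
      by (metis blinfun.diff_right add.commute norm_triangle_sub norm_minus_commute)
    ultimately have "norm (R n l) \<ge> (1/6) * (1/3) ^ n * norm (R n)"
      using Rx[of n] by (simp only: mult_ac)
    moreover have "(1/6) * (1/3) ^ n * norm (R n) \<ge> (1/6) * (1/3) ^ n * (4::real) ^ n"
      using R[of n] by (intro mult_left_mono) auto
    moreover have "(1/6) * (1/3) ^ n * (4::real) ^ n = (1/6) * (4/3) ^ n"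
      by (simp add: power_divide)
    ultimately show ?thesis by linarith
  qed
  obtain K where K: "\<And>n. norm (T n l) \<le> K"
    using pointwise[of l] by (auto simp: bdd_above_def)
  obtain n where "6 * K < (4/3::real) ^ n"
    using real_arch_pow[of "4/3" "6 * K"] by auto
  with big[of n] K[of "m n"] show False by (simp add: R_def)
qed

section \<open>The exponential of a bounded operator\<close>

lemma blinfun_power_norm:
  fixes T :: "'a::real_normed_vector \<Rightarrow>\<^sub>L 'a"
  shows "norm (((o\<^sub>L) T ^^ n) id_blinfun) \<le> norm T ^ n"
proof (induction n)
  case 0
  show ?case by (simp add: norm_blinfun_id_le)
next
  case (Suc n)
  have "norm (T o\<^sub>L ((o\<^sub>L) T ^^ n) id_blinfun) \<le> norm T * norm (((o\<^sub>L) T ^^ n) id_blinfun)"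
    by (rule norm_blinfun_compose)
  also have "\<dots> \<le> norm T * norm T ^ n"
    using Suc by (intro mult_left_mono) auto
  finally show ?case by simp
qed

text \<open>Since \<open>fact (n + 3)\<close> is at least \<open>fact n\<close>, the tail of the
  series from the third power on is dominated by \<open>norm T ^ 3\<close> times the scalar
  exponential series.\<close>

lemma blinfun_exp_taylor2:
  fixes T :: "'a::banach \<Rightarrow>\<^sub>L 'a"
  shows "norm (blinfun_exp T - (id_blinfun + T + (1/2) *\<^sub>R (T o\<^sub>L T))) \<le> norm T ^ 3 * exp (norm T)"
proof -
  define a where "a n = (((o\<^sub>L) T ^^ n) id_blinfun) /\<^sub>R fact n" for n
  have na: "norm (a n) \<le> norm T ^ n /\<^sub>R fact n" for n
    using blinfun_power_norm[where T = T and n = n] by (simp add: a_def divide_right_mono)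
  have "summable (\<lambda>n. norm T ^ n /\<^sub>R fact n)" by (rule summable_exp_generic)
  then have sa: "summable a"
    by (rule summable_comparison_test'[where N = 0]) (rule na)
  have "blinfun_exp T = suminf a" by (simp add: blinfun_exp_def a_def[abs_def])
  also have "\<dots> = (\<Sum>n. a (n + 3)) + (\<Sum>n<3. a n)"
    by (rule suminf_split_initial_segment[OF sa])
  also have "(\<Sum>n<3. a n) = id_blinfun + T + (1/2) *\<^sub>R (T o\<^sub>L T)"
  proof -
    have "T o\<^sub>L id_blinfun = T" by (rule blinfun_eqI) simp
    then show ?thesis by (simp add: a_def numeral_eq_Suc lessThan_Suc fact_numeral)
  qed
  finally have "blinfun_exp T - (id_blinfun + T + (1/2) *\<^sub>R (T o\<^sub>L T)) = (\<Sum>n. a (n + 3))"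
    by simp
  moreover have "norm (\<Sum>n. a (n + 3)) \<le> (\<Sum>n. norm T ^ 3 * (norm T ^ n /\<^sub>R fact n))"
  proof (rule norm_suminf_le)
    fix n
    have "norm (a (n + 3)) \<le> norm T ^ (n + 3) /\<^sub>R fact (n + 3)" by (rule na)
    also have "\<dots> \<le> norm T ^ (n + 3) /\<^sub>R fact n"
      by (simp add: divide_inverse[symmetric] mult.commute[of "inverse _"] del: fact_Suc)
         (intro divide_left_mono fact_mono, auto)
    finally show "norm (a (n + 3)) \<le> norm T ^ 3 * (norm T ^ n /\<^sub>R fact n)"
      by (simp add: power_add mult_ac)
  qed (intro summable_mult summable_exp_generic)
  moreover have "(\<Sum>n. norm T ^ 3 * (norm T ^ n /\<^sub>R fact n)) = norm T ^ 3 * exp (norm T)"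
    by (simp only: exp_def suminf_mult[OF summable_exp_generic])
  ultimately show ?thesis by simp
qed

section \<open>Derivatives as limits of difference quotients\<close>

text \<open>In this form a difference quotient can be moved inside a bounded operator whose time
  argument also varies, as the product rules for the semigroup require.\<close>

lemma has_vector_derivative_iff_quotient:
  "(f has_vector_derivative f') (at x within s) \<longleftrightarrow>
    ((\<lambda>y. (f y - f x) /\<^sub>R (y - x)) \<longlongrightarrow> f') (at x within s)"
proof -
  have "norm ((1 / norm (y - x)) *\<^sub>R (f y - (f x + (y - x) *\<^sub>R f'))) =
      norm ((f y - f x) /\<^sub>R (y - x) - f')" if "y \<noteq> x" for y
  proof -
    have "(f y - f x) /\<^sub>R (y - x) - f' = (1 / (y - x)) *\<^sub>R (f y - (f x + (y - x) *\<^sub>R f'))"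
      using that by (simp add: scaleR_diff_right scaleR_add_right divide_inverse)
    then show ?thesis by simp
  qed
  then have "\<forall>\<^sub>F y in at x within s.
      norm ((1 / norm (y - x)) *\<^sub>R (f y - (f x + (y - x) *\<^sub>R f'))) = norm ((f y - f x) /\<^sub>R (y - x) - f')"
    by (auto simp: eventually_at_filter)
  then have "((\<lambda>y. norm ((1 / norm (y - x)) *\<^sub>R (f y - (f x + (y - x) *\<^sub>R f')))) \<longlongrightarrow> 0) (at x within s) \<longleftrightarrow>
      ((\<lambda>y. norm ((f y - f x) /\<^sub>R (y - x) - f')) \<longlongrightarrow> 0) (at x within s)"
    by (rule tendsto_cong)
  then show ?thesis
    by (simp only: has_vector_derivative_def has_derivative_within tendsto_norm_zero_iff
        bounded_linear_scaleR_left simp_thms Lim_null[of _ f'])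
qed

lemma has_vector_derivative_right_quotient:
  fixes f :: "real \<Rightarrow> 'a::real_normed_vector"
  assumes "(f has_vector_derivative f') (at s within {a..b})" "a \<le> s" "s < b"
  shows "((\<lambda>d. (f (s + d) - f s) /\<^sub>R d) \<longlongrightarrow> f') (at_right 0)"
proof -
  have "((\<lambda>y. (f y - f s) /\<^sub>R (y - s)) \<longlongrightarrow> f') (at s within {a..b})"
    using assms(1) by (simp add: has_vector_derivative_iff_quotient)
  moreover have "filterlim (\<lambda>d. s + d) (at s within {a..b}) (at_right 0)"
  proof (rule filterlim_at_withinI)
    have "((\<lambda>d. s + d) \<longlongrightarrow> s + 0) (at_right 0)" by (intro tendsto_intros)
    then show "filterlim (\<lambda>d. s + d) (nhds s) (at_right 0)" by simp
    have "\<forall>\<^sub>F d in at_right 0. d < b - s"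
      using assms by (intro order_tendstoD(2)[OF tendsto_ident_at]) simp
    moreover have "\<forall>\<^sub>F d in at_right 0. 0 < (d::real)"
      by (rule eventually_at_right_less)
    ultimately show "\<forall>\<^sub>F d in at_right 0. s + d \<in> {a..b} - {s}"
      by eventually_elim (use assms in auto)
  qed
  ultimately show ?thesis
    by (auto dest: filterlim_compose)
qed

section \<open>Strongly continuous semigroups\<close>

locale generated_semigroup =
  fixes D :: "'a::banach set" and A :: "'a \<Rightarrow> 'a" and S :: "real \<Rightarrow> 'a \<Rightarrow>\<^sub>L 'a"
  assumes closed_op: "densely_defined_closed_operator D A"
    and generator: "generates D A S"
begin

lemma S_0 [simp]: "S 0 = id_blinfun"
  and S_add: "0 \<le> s \<Longrightarrow> 0 \<le> t \<Longrightarrow> S (s + t) x = S s (S t x)"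
  and S_tendsto_right: "((\<lambda>t. S t x) \<longlongrightarrow> x) (at_right 0)"
  using generator by (auto simp: generates_def C0_semigroup_def)

lemma D_subspace: "subspace D" and D_dense: "closure D = UNIV"
  and A_add: "x \<in> D \<Longrightarrow> y \<in> D \<Longrightarrow> A (x + y) = A x + A y"
  and A_scaleR: "x \<in> D \<Longrightarrow> A (c *\<^sub>R x) = c *\<^sub>R A x"
  using closed_op by (auto simp: densely_defined_closed_operator_def)

lemma A_diff: "x \<in> D \<Longrightarrow> y \<in> D \<Longrightarrow> A (x - y) = A x - A y"
  using A_add[of x "(-1) *\<^sub>R y"] A_scaleR[of y "-1"] D_subspace
  by (simp add: subspace_neg)

lemma A_tendsto: "x \<in> D \<Longrightarrow> ((\<lambda>t. (S t x - x) /\<^sub>R t) \<longlongrightarrow> A x) (at_right 0)"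
  using generator by (auto simp: generates_def)

lemma in_DI: "((\<lambda>t. (S t x - x) /\<^sub>R t) \<longlongrightarrow> y) (at_right 0) \<Longrightarrow> x \<in> D"
  using generator by (auto simp: generates_def)

lemma S_in_D: assumes "x \<in> D" "0 \<le> t" shows "S t x \<in> D" and A_S: "A (S t x) = S t (A x)"
proof -
  have "((\<lambda>d. S t ((S d x - x) /\<^sub>R d)) \<longlongrightarrow> S t (A x)) (at_right 0)"
    by (intro tendsto_intros A_tendsto assms)
  moreover have "\<forall>\<^sub>F d in at_right 0. S t ((S d x - x) /\<^sub>R d) = (S d (S t x) - S t x) /\<^sub>R d"
    using eventually_at_right_less
  proof eventually_elim
    case (elim d)
    then have "S t (S d x) = S d (S t x)"
      using assms by (simp flip: S_add add: add.commute)
    then show ?case by (simp add: blinfun.scaleR_right blinfun.diff_right)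
  qed
  ultimately have *: "((\<lambda>d. (S d (S t x) - S t x) /\<^sub>R d) \<longlongrightarrow> S t (A x)) (at_right 0)"
    by (simp cong: tendsto_cong)
  then show "S t x \<in> D" by (rule in_DI)
  from A_tendsto[OF this] * show "A (S t x) = S t (A x)"
    by (rule tendsto_unique[rotated]) simp
qed

lemma S_tendsto_at_0:
  assumes "(r \<longlongrightarrow> 0) F" "\<forall>\<^sub>F i in F. 0 \<le> r i"
  shows "((\<lambda>i. S (r i) x) \<longlongrightarrow> x) F"
proof -
  have "continuous (at 0 within {0..}) (\<lambda>t. S t x)"
    using S_tendsto_right[of x] by (simp add: continuous_within at_within_Ici_at_right)
  then have "((\<lambda>i. S (r i) x) \<longlongrightarrow> S 0 x) F"
    by (rule continuous_within_tendsto_compose) (use assms in auto)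
  then show ?thesis by simp
qed

text \<open>Otherwise there are times \<open>t n\<close> tending to 0 with norms above
  \<open>n\<close>. Every orbit converges along these times and is therefore bounded, which
  contradicts uniform boundedness.\<close>

lemma S_bounded_near_0: "\<exists>d>0. \<exists>M. \<forall>t\<in>{0..d}. norm (S t) \<le> M"
proof (rule ccontr)
  assume "\<not> ?thesis"
  then have "\<exists>t\<in>{0..1 / Suc n}. norm (S t) > n" for n :: nat
    by (meson not_le of_nat_0_less_iff zero_less_Suc zero_less_divide_1_iff)
  then obtain t where t: "t n \<in> {0..1 / Suc n}" "norm (S (t n)) > n" for n :: nat
    by metis
  have "t \<longlonglongrightarrow> 0"
    by (rule real_tendsto_sandwich[OF _ _ tendsto_const LIMSEQ_inverse_real_of_nat])
       (use t(1) in \<open>auto simp: divide_inverse\<close>)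
  have "bdd_above (range (\<lambda>n. norm (S (t n) x)))" for x
  proof -
    have "(\<lambda>n. S (t n) x) \<longlonglongrightarrow> x"
      by (rule S_tendsto_at_0) (use \<open>t \<longlonglongrightarrow> 0\<close> t in auto)
    then have "bounded (range (\<lambda>n. S (t n) x))"
      by (rule convergent_imp_bounded)
    then show ?thesis by (auto simp: bounded_iff bdd_above_def)
  qed
  then have "bdd_above (range (\<lambda>n. norm (S (t n))))"
    by (rule uniform_boundedness)
  then obtain K where K: "\<And>n. norm (S (t n)) \<le> K" by (auto simp: bdd_above_def)
  obtain n :: nat where "K < n" using reals_Archimedean2 by blast
  with K[of n] t(2)[of n] show False by simp
qed

lemma S_bdd_above: "bdd_above ((\<lambda>t. norm (S t)) ` {0..a})"
proof -
  obtain d M0 where d: "d > 0" "\<And>t. t \<in> {0..d} \<Longrightarrow> norm (S t) \<le> M0"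
    using S_bounded_near_0 by blast
  \<comment> \<open>With a bound of at least 1 the powers of \<open>M\<close> increase, so the bound
    for \<open>n\<close> pieces of length \<open>d\<close> also covers shorter times.\<close>
  define M where "M = max 1 M0"
  have M: "norm (S t) \<le> M" "M \<ge> 1" if "t \<in> {0..d}" for t
    using d(2)[OF that] by (auto simp: M_def)
  have pow: "norm (S t) \<le> M ^ Suc n" if "t \<in> {0..Suc n * d}" for n t
    using that
  proof (induction n arbitrary: t)
    case (Suc n)
    show ?case
    proof (cases "t \<le> d")
      case True
      with Suc.prems have "norm (S t) \<le> M" "1 \<le> M" using M[of t] by auto
      moreover have "M \<le> M ^ Suc (Suc n)" using \<open>1 \<le> M\<close> by (intro self_le_power) auto
      ultimately show ?thesis by linarith
    next
      case False
      have "S t = S d o\<^sub>L S (t - d)"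
        using S_add[of d "t - d"] False d(1) by (intro blinfun_eqI) simp
      then have "norm (S t) \<le> norm (S d) * norm (S (t - d))"
        by (simp add: norm_blinfun_compose)
      also have "\<dots> \<le> M * M ^ Suc n"
        using M[of d] d(1) False Suc.prems
        by (intro mult_mono Suc.IH) (auto simp: algebra_simps)
      finally show ?thesis by simp
    qed
  qed (use M in auto)
  obtain n :: nat where "a / d \<le> n" using real_arch_simple by blast
  then have "a \<le> Suc n * d" using d(1) by (simp add: field_simps)
  then have "norm (S t) \<le> M ^ Suc n" if "t \<in> {0..a}" for t
    using pow[of t n] that by simp
  then show ?thesis by (intro bdd_aboveI2)
qed

text \<open>Joint continuity in time and vector. The shorter time is factored out of a difference
  \<open>S s z0 - S t z0\<close>, which reduces continuity from the left as well as from the right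
  to continuity at 0; the local norm bound controls the factor and the change of the vector.\<close>

lemma S_tendsto:
  assumes r: "(r \<longlongrightarrow> r0) F" "\<forall>\<^sub>F x in F. 0 \<le> r x" and z: "(z \<longlongrightarrow> z0) F" and r0: "0 \<le> r0"
  shows "((\<lambda>x. S (r x) (z x)) \<longlongrightarrow> S r0 z0) F"
proof -
  obtain M where M: "\<And>t. t \<in> {0..r0 + 1} \<Longrightarrow> norm (S t) \<le> M"
    using S_bdd_above[of "r0 + 1"] unfolding bdd_above_def by blast
  have step: "norm (S s z0 - S t z0) \<le> M * norm (S \<bar>s - t\<bar> z0 - z0)"
    if "s \<in> {0..r0 + 1}" "t \<in> {0..r0 + 1}" for s t
    using that
  proof (induction s t rule: linorder_wlog)
    case (le s t)
    then have "S s z0 - S t z0 = - S s (S (t - s) z0 - z0)"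
      using S_add[of s "t - s" z0] by (simp add: blinfun.diff_right)
    then have "norm (S s z0 - S t z0) \<le> norm (S s) * norm (S (t - s) z0 - z0)"
      using norm_blinfun by (metis norm_minus_cancel)
    also have "\<dots> \<le> M * norm (S (t - s) z0 - z0)"
      using M le by (intro mult_right_mono) auto
    finally show ?case using le by simp
  next
    case (sym s t)
    then show ?case by (simp add: norm_minus_commute abs_minus_commute)
  qed
  have "((\<lambda>x. norm (S \<bar>r x - r0\<bar> z0 - z0)) \<longlongrightarrow> 0) F"
  proof -
    have "((\<lambda>x. \<bar>r x - r0\<bar>) \<longlongrightarrow> 0) F"
      using r(1) by (simp add: tendsto_rabs_zero LIM_zero)
    then have "((\<lambda>x. S \<bar>r x - r0\<bar> z0) \<longlongrightarrow> z0) F"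
      by (rule S_tendsto_at_0) simp
    then show ?thesis by (simp add: tendsto_norm_zero LIM_zero)
  qed
  moreover have "((\<lambda>x. norm (z x - z0)) \<longlongrightarrow> 0) F"
    using z by (simp add: tendsto_norm_zero LIM_zero)
  ultimately have "((\<lambda>x. M * norm (z x - z0) + M * norm (S \<bar>r x - r0\<bar> z0 - z0)) \<longlongrightarrow> M * 0 + M * 0) F"
    by (intro tendsto_intros)
  then have lim: "((\<lambda>x. M * norm (z x - z0) + M * norm (S \<bar>r x - r0\<bar> z0 - z0)) \<longlongrightarrow> 0) F"
    by simp
  have "\<forall>\<^sub>F x in F. r x < r0 + 1" using r(1) by (rule order_tendstoD) simp
  with r(2) have "\<forall>\<^sub>F x in F. norm (S (r x) (z x) - S r0 z0)
      \<le> M * norm (z x - z0) + M * norm (S \<bar>r x - r0\<bar> z0 - z0)"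
  proof eventually_elim
    case (elim x)
    have "S (r x) (z x) - S r0 z0 = S (r x) (z x - z0) + (S (r x) z0 - S r0 z0)"
      by (simp add: blinfun.diff_right)
    then have "norm (S (r x) (z x) - S r0 z0) \<le> norm (S (r x) (z x - z0)) + norm (S (r x) z0 - S r0 z0)"
      by (metis norm_triangle_ineq)
    moreover have "norm (S (r x) (z x - z0)) \<le> M * norm (z x - z0)"
      using M[of "r x"] elim
      by (intro order_trans[OF norm_blinfun] mult_right_mono) auto
    moreover have "norm (S (r x) z0 - S r0 z0) \<le> M * norm (S \<bar>r x - r0\<bar> z0 - z0)"
      using elim r0 by (intro step) auto
    ultimately show ?case by linarith
  qed
  then have "((\<lambda>x. S (r x) (z x) - S r0 z0) \<longlongrightarrow> 0) F"
    by (rule Lim_null_comparison) (rule lim)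
  then show ?thesis by (rule LIM_zero_cancel)
qed

lemma continuous_on_S [continuous_intros]:
  assumes "continuous_on T r" "continuous_on T z" "\<And>x. x \<in> T \<Longrightarrow> 0 \<le> r x"
  shows "continuous_on T (\<lambda>x. S (r x) (z x))"
  unfolding continuous_on
  using assms by (intro ballI S_tendsto) (auto simp: continuous_on eventually_at_filter)

text \<open>The generator is defined by a limit from the right at 0 only. The difference quotient at
  \<open>t\<close> on either side is \<open>S (min s t)\<close> applied to the quotient at 0 with
  step \<open>\<bar>s - t\<bar>\<close>, so joint continuity yields the two-sided
  derivative.\<close>

lemma S_has_vector_derivative:
  assumes "x \<in> D" "0 \<le> t"
  shows "((\<lambda>t. S t x) has_vector_derivative S t (A x)) (at t within {0..})"
proof -
  have "((\<lambda>s. S (min s t) ((S \<bar>s - t\<bar> x - x) /\<^sub>R \<bar>s - t\<bar>)) \<longlongrightarrow> S t (A x)) (at t within {0..})"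
  proof (rule S_tendsto)
    have "((\<lambda>s. min s t) \<longlongrightarrow> min t t) (at t within {0..})"
      by (intro tendsto_intros)
    then show "((\<lambda>s. min s t) \<longlongrightarrow> t) (at t within {0..})" by simp
    have "filterlim (\<lambda>s. \<bar>s - t\<bar>) (at_right 0) (at t within {0..})"
    proof (rule filterlim_at_withinI)
      have "((\<lambda>s. \<bar>s - t\<bar>) \<longlongrightarrow> \<bar>t - t\<bar>) (at t within {0..})"
        by (intro tendsto_intros)
      then show "((\<lambda>s. \<bar>s - t\<bar>) \<longlongrightarrow> 0) (at t within {0..})" by simp
      show "\<forall>\<^sub>F s in at t within {0..}. \<bar>s - t\<bar> \<in> {0<..} - {0}"
        by (auto simp: eventually_at_filter)
    qed
    then show "((\<lambda>s. (S \<bar>s - t\<bar> x - x) /\<^sub>R \<bar>s - t\<bar>) \<longlongrightarrow> A x) (at t within {0..})"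
      by (rule filterlim_compose[OF A_tendsto[OF \<open>x \<in> D\<close>]])
    show "\<forall>\<^sub>F s in at t within {0..}. 0 \<le> min s t"
      using \<open>0 \<le> t\<close> by (auto simp: eventually_at_filter)
  qed fact
  moreover have "S (min s t) ((S \<bar>s - t\<bar> x - x) /\<^sub>R \<bar>s - t\<bar>) = (S s x - S t x) /\<^sub>R (s - t)"
    if "0 \<le> s" "s \<noteq> t" for s
  proof (cases "s \<le> t")
    case True
    then have "S s (S (t - s) x) = S t x" using S_add[of s "t - s"] that by simp
    moreover have "inverse (t - s) = - inverse (s - t)" by (metis inverse_minus_eq minus_diff_eq)
    ultimately show ?thesis using True
      by (simp add: blinfun.scaleR_right blinfun.diff_right scaleR_diff_right)
  next
    case False
    then have "S t (S (s - t) x) = S s x" using S_add[of t "s - t"] \<open>0 \<le> t\<close> by simp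
    then show ?thesis using False
      by (simp add: blinfun.scaleR_right blinfun.diff_right)
  qed
  then have "\<forall>\<^sub>F s in at t within {0..}.
      S (min s t) ((S \<bar>s - t\<bar> x - x) /\<^sub>R \<bar>s - t\<bar>) = (S s x - S t x) /\<^sub>R (s - t)"
    by (auto simp: eventually_at_filter)
  ultimately show ?thesis
    unfolding has_vector_derivative_iff_quotient by (rule Lim_transform_eventually)
qed

text \<open>Product rule for a merely strongly differentiable factor: the quotient of
  \<open>y\<close> is acted on by the bounded \<open>S (a - t)\<close>, and the semigroup itself is
  differentiated at the fixed vector \<open>y s\<close>, the only one to which \<open>A\<close> is
  applied.\<close>

lemma S_flow_has_vector_derivative:
  assumes y: "(y has_vector_derivative y') (at s within {0..a})" and "y s \<in> D" and s: "s \<in> {0..a}"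
  shows "((\<lambda>s. S (a - s) (y s)) has_vector_derivative S (a - s) (y' - A (y s))) (at s within {0..a})"
proof -
  have "((\<lambda>t. S (a - t) ((y t - y s) /\<^sub>R (t - s))) \<longlongrightarrow> S (a - s) y') (at s within {0..a})"
    using y s unfolding has_vector_derivative_iff_quotient
    by (intro S_tendsto tendsto_intros) (auto simp: eventually_at_filter)
  moreover have "((\<lambda>t. (S (a - t) (y s) - S (a - s) (y s)) /\<^sub>R (t - s)) \<longlongrightarrow> - S (a - s) (A (y s)))
      (at s within {0..a})"
  proof -
    have "((\<lambda>t. S t (y s)) has_vector_derivative S (a - s) (A (y s))) (at (a - s) within (\<lambda>t. a - t) ` {0..a})"
      using s by (intro has_vector_derivative_within_subset[OF S_has_vector_derivative] assms) auto
    moreover have "((\<lambda>t. a - t) has_vector_derivative -1) (at s within {0..a})"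
      by (auto intro!: derivative_eq_intros)
    ultimately have "((\<lambda>t. S t (y s)) \<circ> (\<lambda>t. a - t) has_vector_derivative (-1) *\<^sub>R S (a - s) (A (y s)))
        (at s within {0..a})"
      by (intro vector_diff_chain_within)
    then show ?thesis
      by (simp add: has_vector_derivative_iff_quotient o_def)
  qed
  ultimately have "((\<lambda>t. S (a - t) ((y t - y s) /\<^sub>R (t - s)) + (S (a - t) (y s) - S (a - s) (y s)) /\<^sub>R (t - s))
      \<longlongrightarrow> S (a - s) y' + - S (a - s) (A (y s))) (at s within {0..a})"
    by (rule tendsto_add)
  moreover have "S (a - t) ((y t - y s) /\<^sub>R (t - s)) + (S (a - t) (y s) - S (a - s) (y s)) /\<^sub>R (t - s) =
      (S (a - t) (y t) - S (a - s) (y s)) /\<^sub>R (t - s)" for t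
    by (simp add: blinfun.diff_right blinfun.scaleR_right scaleR_diff_right)
  ultimately show ?thesis
    by (simp add: has_vector_derivative_iff_quotient blinfun.diff_right)
qed

section \<open>Averages of the semigroup\<close>

text \<open>The integral is taken orbit by orbit because \<open>S\<close> is continuous only in the
  strong sense, and the result is then packed into a bounded operator.\<close>

definition mean :: "real \<Rightarrow> 'a \<Rightarrow>\<^sub>L 'a" where
  "mean e = Blinfun (\<lambda>x. integral {0..e} (\<lambda>r. S r x) /\<^sub>R e)"

lemma S_integrable: "(\<lambda>r. S r x) integrable_on {0..e}"
  by (intro integrable_continuous_real continuous_intros) auto

lemma norm_integral_S:
  assumes "0 < e" and M: "\<And>t. t \<in> {0..e} \<Longrightarrow> norm (S t) \<le> M"
  shows "norm (integral {0..e} (\<lambda>r. S r x) /\<^sub>R e) \<le> norm x * M"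
proof -
  have "norm (integral {0..e} (\<lambda>r. S r x)) \<le> (M * norm x) * (e - 0)"
  proof (rule integral_bound)
    show "norm (S t x) \<le> M * norm x" if "t \<in> {0..e}" for t
      using that M by (intro order_trans[OF norm_blinfun] mult_right_mono) auto
    show "continuous_on {0..e} (\<lambda>r. S r x)" by (intro continuous_on_S continuous_intros) auto
  qed (use assms in auto)
  then show ?thesis using assms by (simp add: field_simps)
qed

lemma mean_apply: assumes "0 < e" shows "mean e x = integral {0..e} (\<lambda>r. S r x) /\<^sub>R e"
proof -
  obtain M where M: "\<And>t. t \<in> {0..e} \<Longrightarrow> norm (S t) \<le> M"
    using S_bdd_above[of e] unfolding bdd_above_def by blast
  have "bounded_linear (\<lambda>x. integral {0..e} (\<lambda>r. S r x) /\<^sub>R e)"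
    using norm_integral_S[OF assms M]
    by (intro bounded_linear_intro)
       (auto simp: blinfun.add_right blinfun.scaleR_right scaleR_add_right
          integral_add[OF S_integrable S_integrable])
  then show ?thesis by (simp add: mean_def bounded_linear_Blinfun_apply)
qed

lemma norm_mean:
  "0 < e \<Longrightarrow> (\<And>t. t \<in> {0..e} \<Longrightarrow> norm (S t) \<le> M) \<Longrightarrow> norm (mean e x) \<le> M * norm x"
  using norm_integral_S[of e M x] by (simp add: mean_apply mult.commute)

lemma mean_S: assumes "0 < e" "0 \<le> t" shows "mean e (S t x) = S t (mean e x)"
proof -
  have "integral {0..e} (\<lambda>r. S r (S t x)) = integral {0..e} (\<lambda>r. S t (S r x))"
    using assms by (intro integral_cong) (simp flip: S_add add: add.commute)
  also have "\<dots> = S t (integral {0..e} (\<lambda>r. S r x))"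
    by (rule integral_linear[OF S_integrable blinfun.bounded_linear_right, unfolded o_def])
  finally show ?thesis by (simp add: mean_apply assms blinfun.scaleR_right)
qed

text \<open>The right-hand side is bounded in \<open>x\<close> for fixed \<open>e\<close>. This is
  the gain from averaging: \<open>A\<close> can be absorbed without control of the norm of
  \<open>A x\<close>.\<close>

lemma mean_A: assumes "0 < e" "x \<in> D" shows "mean e (A x) = (S e x - x) /\<^sub>R e"
proof -
  have "((\<lambda>r. S r (A x)) has_integral S e x - S 0 x) {0..e}"
    using assms
    by (intro fundamental_theorem_of_calculus has_vector_derivative_within_subset[OF S_has_vector_derivative]) auto
  then show ?thesis by (simp add: mean_apply assms integral_unique)
qed

lemma mean_tendsto: "((\<lambda>e. mean e x) \<longlongrightarrow> x) (at_right 0)"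
proof -
  have "((\<lambda>e. integral {0..e} (\<lambda>r. S r x)) has_vector_derivative S 0 x) (at 0 within {0..1})"
    by (intro integral_has_vector_derivative continuous_intros) auto
  then have "((\<lambda>e. (integral {0..0 + e} (\<lambda>r. S r x) - integral {0..0} (\<lambda>r. S r x)) /\<^sub>R e) \<longlongrightarrow> S 0 x) (at_right 0)"
    by (rule has_vector_derivative_right_quotient) auto
  moreover have "\<forall>\<^sub>F e in at_right 0. mean e x = (integral {0..0 + e} (\<lambda>r. S r x) - integral {0..0} (\<lambda>r. S r x)) /\<^sub>R e"
    by (auto simp: eventually_at_filter mean_apply)
  ultimately have "((\<lambda>e. mean e x) \<longlongrightarrow> S 0 x) (at_right 0)"
    by (simp only: tendsto_cong)
  then show ?thesis by simp
qed

section \<open>Continuous extension of bounded commutators\<close>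

lemma bounded_commutatorD: "bounded_commutator D A P \<Longrightarrow> x \<in> D \<Longrightarrow> P x \<in> D"
  by (auto simp: bounded_commutator_def commutator_domain_def)

text \<open>This justifies the definite description. On \<open>D\<close> the commutator is linear
  and bounded, hence Lipschitz, and extends to the closure of \<open>D\<close>, the whole space;
  linearity, the bound and uniqueness pass to limits of sequences in \<open>D\<close>.\<close>

lemma commutator_ext_apply:
  assumes P: "bounded_commutator D A P" and "x \<in> D"
  shows "commutator_ext D A P x = commutator A P x"
proof -
  let ?c = "commutator A P"
  obtain k0 where k0: "\<And>x. x \<in> D \<Longrightarrow> norm (?c x) \<le> k0 * norm x"
    using P by (auto simp: bounded_commutator_def)
  \<comment> \<open>The bound \<open>k0\<close> may be negative if \<open>D\<close> is trivial,
    whereas a Lipschitz constant may not.\<close>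
  define k where "k = max 0 k0"
  have k: "norm (?c x) \<le> k * norm x" if "x \<in> D" for x
    using k0[OF that] mult_right_mono[of k0 k "norm x"] by (simp add: k_def)
  have k_nonneg: "k \<ge> 0" by (simp add: k_def)
  have c_add: "?c (x + y) = ?c x + ?c y" if "x \<in> D" "y \<in> D" for x y
    using that bounded_commutatorD[OF P]
    by (simp add: commutator_def blinfun.add_right A_add algebra_simps)
  have c_scaleR: "?c (r *\<^sub>R x) = r *\<^sub>R ?c x" if "x \<in> D" for x r
    using that bounded_commutatorD[OF P]
    by (simp add: commutator_def blinfun.scaleR_right A_scaleR scaleR_diff_right)
  have c_diff: "?c (x - y) = ?c x - ?c y" if "x \<in> D" "y \<in> D" for x y
    using c_add[of x "(-1) *\<^sub>R y"] c_scaleR[of y "-1"] that D_subspace by (simp add: subspace_neg)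
  have "k-lipschitz_on D ?c"
    using k c_diff D_subspace k_nonneg
    by (intro lipschitz_onI) (auto simp: dist_norm subspace_diff simp flip: c_diff)
  then have "uniformly_continuous_on D ?c" by (rule lipschitz_on_uniformly_continuous)
  then obtain g where g: "uniformly_continuous_on (closure D) g" "\<And>x. x \<in> D \<Longrightarrow> ?c x = g x"
    by (rule uniformly_continuous_on_extension_on_closure) auto
  have g_lim: "(\<lambda>n. g (X n)) \<longlonglongrightarrow> g x" if "X \<longlonglongrightarrow> x" for X x
    using uniformly_continuous_imp_continuous[OF g(1)] that D_dense
    by (auto simp: continuous_on_tendsto_compose continuous_on_eq_continuous_at isCont_tendsto_compose)
  have seq: "\<exists>X. (\<forall>n. X n \<in> D) \<and> X \<longlonglongrightarrow> x" for x
    using D_dense closure_sequential[of x D] by auto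
  have "bounded_linear g"
  proof (rule bounded_linear_intro)
    fix x y
    obtain X Y where X: "\<And>n. X n \<in> D" "X \<longlonglongrightarrow> x" and Y: "\<And>n. Y n \<in> D" "Y \<longlonglongrightarrow> y"
      using seq by metis
    have "(\<lambda>n. g (X n + Y n)) \<longlonglongrightarrow> g (x + y)" by (intro g_lim tendsto_intros X Y)
    moreover have "g (X n + Y n) = g (X n) + g (Y n)" for n
      using c_add[of "X n" "Y n"] X Y D_subspace by (simp add: g(2) subspace_add)
    moreover have "(\<lambda>n. g (X n) + g (Y n)) \<longlonglongrightarrow> g x + g y" by (intro tendsto_intros g_lim X Y)
    ultimately show "g (x + y) = g x + g y" using LIMSEQ_unique by auto
  next
    fix r x
    obtain X where X: "\<And>n. X n \<in> D" "X \<longlonglongrightarrow> x" using seq by metis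
    have "(\<lambda>n. g (r *\<^sub>R X n)) \<longlonglongrightarrow> g (r *\<^sub>R x)" by (intro g_lim tendsto_intros X)
    moreover have "g (r *\<^sub>R X n) = r *\<^sub>R g (X n)" for n
      using c_scaleR[of "X n" r] X D_subspace by (simp add: g(2) subspace_scale)
    moreover have "(\<lambda>n. r *\<^sub>R g (X n)) \<longlonglongrightarrow> r *\<^sub>R g x" by (intro tendsto_intros g_lim X)
    ultimately show "g (r *\<^sub>R x) = r *\<^sub>R g x" using LIMSEQ_unique by auto
  next
    fix x
    obtain X where X: "\<And>n. X n \<in> D" "X \<longlonglongrightarrow> x" using seq by metis
    have "(\<lambda>n. norm (g (X n))) \<longlonglongrightarrow> norm (g x)" "(\<lambda>n. norm (X n) * k) \<longlonglongrightarrow> norm x * k"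
      by (intro tendsto_intros g_lim X)+
    then show "norm (g x) \<le> norm x * k"
      by (rule LIMSEQ_le) (use k X in \<open>auto simp flip: g(2) simp: mult.commute\<close>)
  qed
  then have ex: "\<forall>x\<in>D. Blinfun g x = ?c x"
    by (simp add: bounded_linear_Blinfun_apply g)
  have "\<forall>x\<in>D. commutator_ext D A P x = ?c x"
    unfolding commutator_ext_def
  proof (rule theI)
    show "\<forall>x\<in>D. Blinfun g x = ?c x" by (rule ex)
    fix K :: "'a \<Rightarrow>\<^sub>L 'a" assume K: "\<forall>x\<in>D. K x = ?c x"
    show "K = Blinfun g"
    proof (rule blinfun_eqI)
      fix x
      obtain X where X: "\<And>n. X n \<in> D" "X \<longlonglongrightarrow> x" using seq by metis
      have "(\<lambda>n. K (X n)) \<longlonglongrightarrow> K x" "(\<lambda>n. Blinfun g (X n)) \<longlonglongrightarrow> Blinfun g x"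
        by (intro tendsto_intros X)+
      then show "K x = Blinfun g x"
        using K ex X(1) LIMSEQ_unique by auto
    qed
  qed
  then show ?thesis using \<open>x \<in> D\<close> by blast
qed

end

section \<open>Operators between two semigroup factors\<close>

context generated_semigroup
begin

text \<open>Differentiating the inner factor produces \<open>T s (A x)\<close> and differentiating
  the outer one \<open>- A (T s x)\<close>, both along the orbit. The two unbounded contributions
  combine into the commutator.\<close>

lemma sandwich_has_vector_derivative:
  fixes T :: "real \<Rightarrow> 'a \<Rightarrow>\<^sub>L 'a"
  assumes T: "(T has_vector_derivative T') (at s within {0..a})"
    and "T s (S s x) \<in> D" "x \<in> D" and s: "s \<in> {0..a}"
  shows "((\<lambda>s. S (a - s) (T s (S s x))) has_vector_derivative
    S (a - s) (commutator A (T s) (S s x) + T' (S s x))) (at s within {0..a})"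
proof -
  have "((\<lambda>s. S s x) has_vector_derivative S s (A x)) (at s within {0..a})"
    using s \<open>x \<in> D\<close>
    by (intro has_vector_derivative_within_subset[OF S_has_vector_derivative]) auto
  with T have "((\<lambda>s. T s (S s x)) has_vector_derivative T s (S s (A x)) + T' (S s x)) (at s within {0..a})"
    by (rule blinfun.has_vector_derivative)
  from S_flow_has_vector_derivative[OF this \<open>T s (S s x) \<in> D\<close> s] show ?thesis
    using s \<open>x \<in> D\<close> by (simp add: commutator_def A_S algebra_simps)
qed

text \<open>Used with \<open>T\<close> equal to \<open>B\<close> and to the square of
  \<open>B\<close>.\<close>

lemma sandwich_lipschitz:
  fixes T :: "real \<Rightarrow> 'a \<Rightarrow>\<^sub>L 'a"
  assumes T: "\<And>s. s \<in> {0..a} \<Longrightarrow> (T has_vector_derivative T' s) (at s within {0..a})"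
    and TD: "\<And>s x. s \<in> {0..a} \<Longrightarrow> x \<in> D \<Longrightarrow> T s x \<in> D"
    and comm: "\<And>s x. s \<in> {0..a} \<Longrightarrow> x \<in> D \<Longrightarrow> norm (commutator A (T s) x) \<le> k * norm x"
    and T': "\<And>s. s \<in> {0..a} \<Longrightarrow> norm (T' s) \<le> l"
    and M: "\<And>s. s \<in> {0..a} \<Longrightarrow> norm (S s) \<le> M"
    and "x \<in> D" "s \<in> {0..a}" "t \<in> {0..a}" "0 \<le> k" "0 \<le> l"
  shows "norm (S (a - s) (T s (S s x)) - S (a - t) (T t (S t x)))
    \<le> M * ((k + l) * (M * norm x)) * \<bar>s - t\<bar>"
proof (rule vector_derivative_bound)
  fix s assume s: "s \<in> {0..a}"
  then have "0 \<le> s" by simp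
  show "((\<lambda>s. S (a - s) (T s (S s x))) has_vector_derivative
    S (a - s) (commutator A (T s) (S s x) + T' s (S s x))) (at s within {0..a})"
    using assms s S_in_D[OF \<open>x \<in> D\<close> \<open>0 \<le> s\<close>] by (intro sandwich_has_vector_derivative T) auto
  have "norm (S s x) \<le> M * norm x"
    using M[OF s] by (intro order_trans[OF norm_blinfun] mult_right_mono) auto
  moreover have "norm (commutator A (T s) (S s x) + T' s (S s x)) \<le> k * norm (S s x) + l * norm (S s x)"
    using S_in_D[OF \<open>x \<in> D\<close> \<open>0 \<le> s\<close>] s T'
    by (intro norm_triangle_mono comm order_trans[OF norm_blinfun] mult_right_mono) auto
  moreover have "k * norm (S s x) + l * norm (S s x) \<le> (k + l) * (M * norm x)"
    using calculation(1) \<open>0 \<le> k\<close> \<open>0 \<le> l\<close>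
    by (simp only: distrib_right[symmetric]) (intro mult_left_mono add_nonneg_nonneg)
  ultimately have "norm (commutator A (T s) (S s x) + T' s (S s x)) \<le> (k + l) * (M * norm x)"
    by linarith
  then show "norm (S (a - s) (commutator A (T s) (S s x) + T' s (S s x))) \<le> M * ((k + l) * (M * norm x))"
    using M[of "a - s"] s order_trans[OF norm_ge_zero M[OF s]]
    by (intro order_trans[OF norm_blinfun] mult_mono) auto
qed (use assms in auto)

end

section \<open>First-order expansion of the integrand\<close>

text \<open>The real parameters are abstract bounds, later instantiated with the suprema of the
  theorem, \<open>E\<close> being \<open>error_max\<close>. The bound \<open>H\<close> on the step
  size keeps \<open>h\<close> itself out of the constants.\<close>

locale splitting = generated_semigroup D A S
  for D :: "'a::banach set" and A S +
  fixes B B' B'' :: "real \<Rightarrow> 'a \<Rightarrow>\<^sub>L 'a" and u :: "real \<Rightarrow> 'a" and u0 :: 'a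
    and h H E b b1 b2 k M :: real
  assumes h: "0 < h" "h \<le> H"
    and B_C2: "C2_on h B B' B''"
    and solution: "C1_solution D A B h u0 u"
    and comm_B: "\<And>s. s \<in> {0..h} \<Longrightarrow> bounded_commutator D A (B s)"
    and domain_K: "\<And>s. s \<in> {0..h} \<Longrightarrow> S s u0 \<in> commutator_domain D (commutator_ext D A (B s))"
    and domain_B': "\<And>s. s \<in> {0..h} \<Longrightarrow> S s u0 \<in> commutator_domain D (B' s)"
    and S_le: "\<And>s. s \<in> {0..h} \<Longrightarrow> norm (S s) \<le> M"
    and B_le: "\<And>s. s \<in> {0..h} \<Longrightarrow> norm (B s) \<le> b"
    and B'_le: "\<And>s. s \<in> {0..h} \<Longrightarrow> norm (B' s) \<le> b1"
    and B''_le: "\<And>s. s \<in> {0..h} \<Longrightarrow> norm (B'' s) \<le> b2"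
    and K_le: "\<And>s. s \<in> {0..h} \<Longrightarrow> norm (commutator_ext D A (B s)) \<le> k"
    and comm_K_le: "\<And>s. s \<in> {0..h} \<Longrightarrow>
      norm (commutator A (commutator_ext D A (B s)) (S s u0)) \<le> E"
    and comm_B'_le: "\<And>s. s \<in> {0..h} \<Longrightarrow> norm (commutator A (B' s) (S s u0)) \<le> E"
    and u0_le: "norm u0 \<le> E"
begin

abbreviation K :: "real \<Rightarrow> 'a \<Rightarrow>\<^sub>L 'a" where "K s \<equiv> commutator_ext D A (B s)"

lemma nonneg: "0 \<le> M" "0 \<le> b" "0 \<le> b1" "0 \<le> b2" "0 \<le> k" "0 \<le> E"
  using h order_trans[OF norm_ge_zero S_le[of 0]] order_trans[OF norm_ge_zero B_le[of 0]]
    order_trans[OF norm_ge_zero B'_le[of 0]] order_trans[OF norm_ge_zero B''_le[of 0]]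
    order_trans[OF norm_ge_zero K_le[of 0]] order_trans[OF norm_ge_zero u0_le]
  by auto

lemma norm_S_apply: "s \<in> {0..h} \<Longrightarrow> norm x \<le> c \<Longrightarrow> norm (S s x) \<le> M * c"
  using S_le nonneg(1) by (intro order_trans[OF norm_blinfun] mult_mono) auto

lemma norm_B_apply: "s \<in> {0..h} \<Longrightarrow> norm x \<le> c \<Longrightarrow> norm (B s x) \<le> b * c"
  using B_le nonneg(2) by (intro order_trans[OF norm_blinfun] mult_mono) auto

lemma B_deriv: "s \<in> {0..h} \<Longrightarrow> (B has_vector_derivative B' s) (at s within {0..h})"
  and B'_deriv: "s \<in> {0..h} \<Longrightarrow> (B' has_vector_derivative B'' s) (at s within {0..h})"
  using B_C2 by (auto simp: C2_on_def)

lemma u_0: "u 0 = u0" and u_D: "t \<in> {0..h} \<Longrightarrow> u t \<in> D"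
  and u_deriv: "t \<in> {0..h} \<Longrightarrow> (u has_vector_derivative (A (u t) + B t (u t))) (at t within {0..h})"
  using solution by (auto simp: C1_solution_def)

lemma u0_D: "u0 \<in> D"
  using u_D[of 0] u_0 h by simp

lemma B_D: "s \<in> {0..h} \<Longrightarrow> x \<in> D \<Longrightarrow> B s x \<in> D"
  and K_apply: "s \<in> {0..h} \<Longrightarrow> x \<in> D \<Longrightarrow> K s x = commutator A (B s) x"
  using comm_B bounded_commutatorD commutator_ext_apply by blast+

lemma norm_comm_B: "s \<in> {0..h} \<Longrightarrow> x \<in> D \<Longrightarrow> norm (commutator A (B s) x) \<le> k * norm x"
  using K_apply[of s x] K_le[of s] norm_blinfun[of "K s" x] mult_right_mono[of "norm (K s)" k "norm x"]
  by simp

text \<open>The formal derivative of \<open>f'\<close> is \<open>S (h - s) (W s)\<close>. The factor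
  2 arises because the commutator of \<open>B'\<close> with \<open>A\<close> occurs twice: in the
  commutator of \<open>C_op\<close> with \<open>A\<close>, and in the time derivative of the
  commutator of \<open>B\<close>.\<close>

definition W :: "real \<Rightarrow> 'a" where
  "W s = commutator A (K s) (S s u0) + 2 *\<^sub>R commutator A (B' s) (S s u0) + B'' s (S s u0)"

lemma norm_W: assumes "s \<in> {0..h}" shows "norm (W s) \<le> (3 + b2 * M) * E"
proof -
  have "norm (B'' s (S s u0)) \<le> b2 * (M * E)"
    by (rule order_trans[OF norm_blinfun mult_mono])
       (use B''_le[OF assms] norm_S_apply[OF assms u0_le] nonneg in auto)
  moreover have "norm (2 *\<^sub>R commutator A (B' s) (S s u0)) \<le> 2 * E"
    using comm_B'_le[OF assms] by simp
  ultimately have "norm (W s) \<le> E + 2 * E + b2 * (M * E)"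
    unfolding W_def by (intro norm_triangle_mono comm_K_le assms)
  then show ?thesis by (simp add: algebra_simps)
qed

definition f where "f s = S (h - s) (B s (S s u0))"
definition f' where "f' s = S (h - s) (C_op D A B B' s (S s u0))"

lemma f_has_vector_derivative:
  assumes "s \<in> {0..h}" shows "(f has_vector_derivative f' s) (at s within {0..h})"
proof -
  have x: "S s u0 \<in> D" using assms u0_D by (intro S_in_D) auto
  then show ?thesis
    using sandwich_has_vector_derivative[OF B_deriv[OF assms] B_D[OF assms x] u0_D assms]
      K_apply[OF assms x]
    by (simp add: f_def[abs_def] f'_def C_op_def blinfun.add_left)
qed

text \<open>This is the difference quotient of the averaged \<open>f'\<close> with the common outer
  factor \<open>S (h - s - d)\<close> taken off.\<close>

lemma C_has_right_derivative:
  assumes s: "0 \<le> s" "s < h" and e: "0 < e"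
  shows "((\<lambda>d. mean e (C_op D A B B' (s + d) (S d (S s u0)) - S d (C_op D A B B' s (S s u0))) /\<^sub>R d)
    \<longlongrightarrow> mean e (W s)) (at_right 0)"
proof -
  define x where "x = S s u0"
  have sh: "s \<in> {0..h}" using s by simp
  have x: "x \<in> D" "K s x \<in> D" "B' s x \<in> D"
    using domain_K[OF sh] domain_B'[OF sh] by (auto simp: x_def commutator_domain_def)
  define qB where "qB d = (B (s + d) - B s) /\<^sub>R d" for d
  define qB' where "qB' d = (B' (s + d) - B' s) /\<^sub>R d" for d
  have qB: "(qB \<longlongrightarrow> B' s) (at_right 0)" and qB': "(qB' \<longlongrightarrow> B'' s) (at_right 0)"
    unfolding qB_def[abs_def] qB'_def[abs_def]
    using B_deriv[OF sh] B'_deriv[OF sh] s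
    by (auto intro!: has_vector_derivative_right_quotient)
  define q where "q d y = (S d y - y) /\<^sub>R d" for d y
  have q: "((\<lambda>d. q d y) \<longlongrightarrow> A y) (at_right 0)" if "y \<in> D" for y
    unfolding q_def using that by (rule A_tendsto)
  \<comment> \<open>The first group moves the orbit with \<open>K s\<close> fixed and tends to the
    double commutator. The second is the time increment of \<open>K\<close>, already rewritten
    through \<open>B\<close>. The third collects all terms with \<open>B'\<close>.\<close>
  let ?r = "\<lambda>d. mean e (K s (q d x) - q d (K s x))
    + (mean e (qB d (S d (A x))) - q e (qB d (S d x)))
    + mean e (qB' d (S d x) + B' s (q d x) - q d (B' s x))"
  have "(?r \<longlongrightarrow> mean e (K s (A x) - A (K s x)) + (mean e (B' s (A x)) - q e (B' s x))
      + mean e (B'' s x + B' s (A x) - A (B' s x))) (at_right 0)"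
    unfolding q_def[of e]
    by (intro tendsto_intros q x qB qB' S_tendsto_right)
  moreover have "mean e (K s (A x) - A (K s x)) + (mean e (B' s (A x)) - q e (B' s x))
      + mean e (B'' s x + B' s (A x) - A (B' s x)) = mean e (W s)"
  proof -
    \<comment> \<open>After the limit \<open>d\<close> to 0 the absorbed operator is restored:
      \<open>B' s x\<close> lies in \<open>D\<close>, so the quotient \<open>q e\<close> turns back
      into an average of \<open>A (B' s x)\<close> and completes a commutator.\<close>
    have "q e (B' s x) = mean e (A (B' s x))" using mean_A[OF e x(3)] by (simp add: q_def)
    then show ?thesis
      by (simp add: W_def x_def[symmetric] commutator_def blinfun.add_right blinfun.diff_right
          blinfun.scaleR_right scaleR_2)
  qed
  moreover have "\<forall>\<^sub>F d in at_right 0. ?r d =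
      mean e (C_op D A B B' (s + d) (S d x) - S d (C_op D A B B' s x)) /\<^sub>R d"
  proof -
    have "\<forall>\<^sub>F d in at_right 0. d < h - s"
      using s by (intro order_tendstoD(2)[OF tendsto_ident_at]) simp
    with eventually_at_right_less show ?thesis
    proof eventually_elim
      case (elim d)
      then have sdh: "s + d \<in> {0..h}" and d: "0 \<le> d" using s by auto
      define y where "y = S d x"
      have y: "y \<in> D" "A y = S d (A x)" using S_in_D[OF x(1) d] A_S[OF x(1) d] by (auto simp: y_def)
      have By: "B (s + d) y \<in> D" "B s y \<in> D" using B_D y sdh sh by auto
      have "mean e (K (s + d) y - K s y) =
          mean e ((B (s + d) - B s) (A y)) - mean e (A (B (s + d) y - B s y))"
        using K_apply[OF sdh y(1)] K_apply[OF sh y(1)] By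
        by (simp add: commutator_def A_diff blinfun.diff_right blinfun.diff_left)
      \<comment> \<open>The norm limit of the quotients of \<open>B\<close> does not control
        \<open>A\<close> applied to them; in \<open>q e\<close>, with \<open>e\<close> fixed, only
        bounded operators are left.\<close>
      moreover have "mean e (A (B (s + d) y - B s y)) = q e ((B (s + d) - B s) y)"
        using By mean_A[OF e] D_subspace by (simp add: subspace_diff q_def blinfun.diff_left)
      moreover have "qB d z = (B (s + d) - B s) z /\<^sub>R d" for z
        by (simp add: qB_def blinfun.scaleR_left)
      ultimately have *: "mean e (K (s + d) y - K s y) /\<^sub>R d = mean e (qB d (A y)) - q e (qB d y)"
        by (simp add: q_def blinfun.scaleR_right blinfun.diff_right scaleR_diff_right mult.commute)
      have "C_op D A B B' (s + d) y - S d (C_op D A B B' s x) =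
          (K s y - K s x - (S d (K s x) - K s x)) + (K (s + d) y - K s y)
          + ((B' (s + d) - B' s) y + (B' s y - B' s x) - (S d (B' s x) - B' s x))"
        by (simp add: C_op_def blinfun.add_left blinfun.add_right blinfun.diff_left)
      then have "mean e (C_op D A B B' (s + d) y - S d (C_op D A B B' s x)) /\<^sub>R d =
          mean e ((K s y - K s x - (S d (K s x) - K s x)) /\<^sub>R d) + mean e (K (s + d) y - K s y) /\<^sub>R d
          + mean e (((B' (s + d) - B' s) y + (B' s y - B' s x) - (S d (B' s x) - B' s x)) /\<^sub>R d)"
        by (simp only: blinfun.add_right blinfun.scaleR_right scaleR_add_right)
      also have "(K s y - K s x - (S d (K s x) - K s x)) /\<^sub>R d = K s (q d x) - q d (K s x)"
        by (simp add: q_def y_def blinfun.scaleR_right blinfun.diff_right scaleR_diff_right)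
      also have "((B' (s + d) - B' s) y + (B' s y - B' s x) - (S d (B' s x) - B' s x)) /\<^sub>R d =
          qB' d y + B' s (q d x) - q d (B' s x)"
      proof -
        have "qB' d y = (B' (s + d) - B' s) y /\<^sub>R d"
          by (simp add: qB'_def blinfun.scaleR_left)
        then show ?thesis
          by (simp add: q_def y_def blinfun.scaleR_right blinfun.diff_right scaleR_diff_right
              scaleR_add_right)
      qed
      finally show ?case by (simp only: *[unfolded y(2), unfolded y_def] y_def)
    qed
  qed
  ultimately have "((\<lambda>d. mean e (C_op D A B B' (s + d) (S d x) - S d (C_op D A B B' s x)) /\<^sub>R d)
      \<longlongrightarrow> mean e (W s)) (at_right 0)"
    by (auto intro: Lim_transform_eventually)
  then show ?thesis by (simp only: x_def)
qed

text \<open>\<open>f'\<close> need not be differentiable under the given hypotheses, but its semigroup means have a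
  right derivative: \<open>mean e\<close> absorbs the operator \<open>A\<close> standing to the left of \<open>B (s + d) - B s\<close>.\<close>

lemma f'_lipschitz:
  assumes "s \<in> {0..h}" "t \<in> {0..h}"
  shows "norm (f' s - f' t) \<le> M * (M * ((3 + b2 * M) * E)) * \<bar>s - t\<bar>"
  using assms
proof (induction s t rule: linorder_wlog)
  case (le s t)
  \<comment> \<open>The bound is free of \<open>e\<close>; one factor \<open>M\<close> comes from
    the average and one from the outer semigroup. The restriction \<open>e \<le> h\<close> keeps the
    averaging inside the interval where \<open>M\<close> bounds the semigroup.\<close>
  have mean_bound: "norm (mean e (f' t) - mean e (f' s)) \<le> M * (M * ((3 + b2 * M) * E)) * (t - s)"
    if e: "0 < e" "e \<le> h" for e
  proof (rule right_derivative_bound[OF le(1)])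
    let ?C = "C_op D A B B'"
    define y where "y r = B r (S r u0)" for r
    have "continuous_on {0..h} B" "continuous_on {0..h} B'"
      unfolding continuous_on_eq_continuous_within
      by (blast intro: has_vector_derivative_continuous B_deriv B'_deriv)+
    note cont = this
    \<comment> \<open>Continuity in \<open>r\<close> cannot be read off from \<open>f'\<close>,
      which contains \<open>K r\<close>. Here \<open>K r\<close> is expressed through
      \<open>B r\<close>, and the average absorbs the \<open>A\<close> standing to its left, so that
      only continuous ingredients remain.\<close>
    have eq: "mean e (f' r) = S (h - r) (mean e (B r (S r (A u0))) - (S e (y r) - y r) /\<^sub>R e + mean e (B' r (S r u0)))"
      if "r \<in> {0..h}" for r
    proof -
      have r: "0 \<le> r" "0 \<le> h - r" "S r u0 \<in> D" using that u0_D S_in_D by auto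
      have "mean e (A (y r)) = (S e (y r) - y r) /\<^sub>R e"
        using B_D[OF that r(3)] e by (intro mean_A) (auto simp: y_def)
      moreover have "mean e (f' r) = S (h - r) (mean e (K r (S r u0) + B' r (S r u0)))"
        unfolding f'_def using e r by (simp add: mean_S C_op_def blinfun.add_left)
      ultimately show ?thesis
        using K_apply[OF that r(3)]
        by (simp add: commutator_def y_def blinfun.add_right blinfun.diff_right A_S u0_D r)
    qed
    have "continuous_on {0..h} (\<lambda>r. S (h - r)
        (mean e (B r (S r (A u0))) - (S e (y r) - y r) /\<^sub>R e + mean e (B' r (S r u0))))"
      unfolding y_def by (intro continuous_intros continuous_on_S cont) auto
    then have "continuous_on {0..h} (\<lambda>r. mean e (f' r))"
      by (rule continuous_on_eq) (rule eq[symmetric])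
    then show "continuous_on {s..t} (\<lambda>r. mean e (f' r))"
      by (rule continuous_on_subset) (use le in auto)
    fix r assume "s \<le> r" "r < t"
    then have r: "0 \<le> r" "r < h" "r \<in> {0..h}" using le by auto
    have "((\<lambda>d. S (h - r - d) (mean e (?C (r + d) (S d (S r u0)) - S d (?C r (S r u0))) /\<^sub>R d))
        \<longlongrightarrow> S (h - r) (mean e (W r))) (at_right 0)"
    proof (rule S_tendsto)
      have "((\<lambda>d. h - r - d) \<longlongrightarrow> h - r - 0) (at_right 0)" by (intro tendsto_intros)
      then show "((\<lambda>d. h - r - d) \<longlongrightarrow> h - r) (at_right 0)" by simp
      then show "\<forall>\<^sub>F d in at_right 0. 0 \<le> h - r - d"
        using r by (auto dest!: order_tendstoD(1)[where a = 0] elim: eventually_mono)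
    qed (use r e C_has_right_derivative in auto)
    moreover have "\<forall>\<^sub>F d in at_right 0.
        S (h - r - d) (mean e (?C (r + d) (S d (S r u0)) - S d (?C r (S r u0))) /\<^sub>R d) =
        (mean e (f' (r + d)) - mean e (f' r)) /\<^sub>R d"
    proof -
      have "\<forall>\<^sub>F d in at_right 0. d < h - r"
        using r by (intro order_tendstoD(2)[OF tendsto_ident_at]) simp
      with eventually_at_right_less show ?thesis
      proof eventually_elim
        case (elim d)
        have "f' (r + d) = S (h - r - d) (?C (r + d) (S d (S r u0)))"
          using S_add[of d r u0] elim r by (simp add: f'_def add.commute diff_diff_eq)
        moreover have "f' r = S (h - r - d) (S d (?C r (S r u0)))"
          using S_add[of "h - r - d" d "?C r (S r u0)"] elim by (simp add: f'_def)
        ultimately show ?case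
          using elim e by (simp add: mean_S blinfun.diff_right blinfun.scaleR_right)
      qed
    qed
    ultimately show "((\<lambda>d. (mean e (f' (r + d)) - mean e (f' r)) /\<^sub>R d) \<longlongrightarrow> S (h - r) (mean e (W r))) (at_right 0)"
      by (rule Lim_transform_eventually)
    have "norm (mean e (W r)) \<le> M * norm (W r)"
      using e S_le by (intro norm_mean) auto
    also have "\<dots> \<le> M * ((3 + b2 * M) * E)"
      using norm_W[OF r(3)] nonneg by (intro mult_left_mono)
    finally show "norm (S (h - r) (mean e (W r))) \<le> M * (M * ((3 + b2 * M) * E))"
      using r by (intro norm_S_apply) auto
  qed
  have "norm (f' t - f' s) \<le> M * (M * ((3 + b2 * M) * E)) * (t - s)"
  \<comment> \<open>The averages converge pointwise to the identity as \<open>e\<close> tends to 0,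
    and the uniform bound passes to the limit.\<close>
  proof (rule tendsto_upperbound)
    show "((\<lambda>e. norm (mean e (f' t) - mean e (f' s))) \<longlongrightarrow> norm (f' t - f' s)) (at_right 0)"
      by (intro tendsto_intros mean_tendsto)
    have "\<forall>\<^sub>F e in at_right 0. e < h"
      using h by (intro order_tendstoD(2)[OF tendsto_ident_at]) simp
    with eventually_at_right_less
    show "\<forall>\<^sub>F e in at_right 0. norm (mean e (f' t) - mean e (f' s)) \<le> M * (M * ((3 + b2 * M) * E)) * (t - s)"
      by eventually_elim (use mean_bound in auto)
  qed simp
  then show ?case using le by (simp add: norm_minus_commute)
next
  case (sym s t)
  then show ?case by (simp add: norm_minus_commute abs_minus_commute)
qed

text \<open>The Lipschitz bound on \<open>f'\<close> takes the place of a second derivative: over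
  the interval \<open>f'\<close> deviates from \<open>f' t\<close> by at most \<open>h\<close> times
  its Lipschitz constant.\<close>

lemma f_taylor:
  assumes "s \<in> {0..h}" "t \<in> {0..h}"
  shows "norm (f s - f t - (s - t) *\<^sub>R f' t) \<le> h\<^sup>2 * (M * (M * ((3 + b2 * M) * E)))"
proof -
  define L where "L = M * (M * ((3 + b2 * M) * E))"
  have L: "0 \<le> L" using nonneg by (simp add: L_def)
  have "norm (f s - f t - (s - t) *\<^sub>R f' t) \<le> norm (s - t) * (L * h)"
  proof (rule vector_differentiable_bound_linearization[where S = "{0..h}"])
    show "norm (f' x - f' t) \<le> L * h" if x: "x \<in> {0..h}" for x
    proof -
      from x have "norm (f' x - f' t) \<le> L * \<bar>x - t\<bar>"
        using assms f'_lipschitz by (simp add: L_def)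
      also have "\<dots> \<le> L * h" using L x assms by (intro mult_left_mono) auto
      finally show ?thesis .
    qed
    show "closed_segment t s \<subseteq> {0..h}"
      using assms by (simp add: closed_segment_subset)
  qed (use assms in \<open>simp_all add: f_has_vector_derivative\<close>)
  also have "\<dots> \<le> h * (L * h)"
    using assms L h by (intro mult_right_mono) auto
  finally show ?thesis by (simp add: L_def power2_eq_square mult_ac)
qed

end

section \<open>Constants\<close>

text \<open>The rate in the exponential is that of the weight used in \<open>norm_u\<close>; the
  leading 2 results from absorbing half of the weighted maximum.\<close>

definition growth :: "real \<Rightarrow> real \<Rightarrow> real \<Rightarrow> real" where
  "growth H b M = 2 * M * exp ((2 * M * b + 1) * H)"

text \<open>The first summand pays for replacing \<open>u\<close> by the free orbit inside Duhamel's
  formula, the second is the Lipschitz constant of \<open>B\<close> between two semigroup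
  factors.\<close>

definition duhamel_const :: "real \<Rightarrow> real \<Rightarrow> real \<Rightarrow> real \<Rightarrow> real \<Rightarrow> real" where
  "duhamel_const H b b1 k M = M * b * M * b * growth H b M + M * (k + b1) * M"

text \<open>One summand for each error of the expanded integrand: the remainder in the expansion of
  \<open>u\<close>, the variation of \<open>G\<close>, and the Taylor remainder of
  \<open>f\<close>.\<close>

definition quadrature_const :: "real \<Rightarrow> real \<Rightarrow> real \<Rightarrow> real \<Rightarrow> real \<Rightarrow> real \<Rightarrow> real" where
  "quadrature_const H b b1 b2 k M =
    M * b * duhamel_const H b b1 k M + M * (2 * b * k + 2 * b * b1) * M + M * M * (3 + b2 * M)"

text \<open>\<open>\<beta>\<close> bounds the norm of the exponent divided by \<open>h\<close>. The
  first summand is the Taylor remainder of the exponential, the second the part of the squared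
  exponent beyond order two.\<close>

definition exponential_const :: "real \<Rightarrow> real \<Rightarrow> real \<Rightarrow> real \<Rightarrow> real" where
  "exponential_const H b b1 k =
    (let \<beta> = b + H * (k + b1) / 2 in \<beta> ^ 3 * exp (H * \<beta>) + (k + b1) * (\<beta> + b) / 4)"

section \<open>Duhamel estimates for the solution\<close>

context splitting
begin

lemma duhamel_has_vector_derivative:
  assumes "a \<in> {0..h}" "s \<in> {0..a}"
  shows "((\<lambda>s. S (a - s) (u s)) has_vector_derivative S (a - s) (B s (u s))) (at s within {0..a})"
proof -
  have "(u has_vector_derivative (A (u s) + B s (u s))) (at s within {0..a})"
    using assms by (intro has_vector_derivative_within_subset[OF u_deriv]) auto
  from S_flow_has_vector_derivative[OF this] show ?thesis
    using assms u_D[of s] by simp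
qed

text \<open>A weighted maximum norm replaces Gronwall's inequality. At the point where
  \<open>exp (- l * t) * norm (u t)\<close> attains its maximum \<open>m\<close>, Duhamel's formula
  gives \<open>m \<le> M * E + m / 2\<close>.\<close>

lemma norm_u:
  assumes "t \<in> {0..h}" shows "norm (u t) \<le> growth H b M * E"
proof -
  \<comment> \<open>Chosen so that \<open>M * b / l\<close> is at most \<open>1 / 2\<close>; the
    added 1 keeps \<open>l\<close> positive when \<open>b\<close> is 0.\<close>
  define l where "l = 2 * M * b + 1"
  have l: "l > 0" using nonneg by (simp add: l_def add_nonneg_pos)
  have "continuous_on {0..h} u"
    unfolding continuous_on_eq_continuous_within
    by (blast intro: has_vector_derivative_continuous u_deriv)
  then have "continuous_on {0..h} (\<lambda>t. exp (- l * t) * norm (u t))"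
    by (intro continuous_intros)
  then obtain t0 where t0: "t0 \<in> {0..h}"
    "\<And>r. r \<in> {0..h} \<Longrightarrow> exp (- l * r) * norm (u r) \<le> exp (- l * t0) * norm (u t0)"
    using continuous_attains_sup[of "{0..h}" "\<lambda>t. exp (- l * t) * norm (u t)"] h by auto
  define m where "m = exp (- l * t0) * norm (u t0)"
  have "0 \<le> m" by (simp add: m_def)
  have u_le: "norm (u r) \<le> m * exp (l * r)" if "r \<in> {0..h}" for r
    using t0(2)[OF that] by (simp add: m_def exp_minus field_simps)
  \<comment> \<open>A primitive of the bound on the derivative in Duhamel's formula.\<close>
  define g where "g r = M * b * m / l * exp (l * r)" for r
  have "norm (S (t0 - t0) (u t0) - S (t0 - 0) (u 0)) \<le> g t0 - g 0"
  proof (cases "t0 = 0")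
    case False
    then have "0 < t0" using t0(1) by simp
    then show ?thesis
    proof (rule differentiable_bound_general)
      show "continuous_on {0..t0} (\<lambda>r. S (t0 - r) (u r))"
        unfolding continuous_on_eq_continuous_within
        by (blast intro: has_vector_derivative_continuous duhamel_has_vector_derivative t0(1))
      show "continuous_on {0..t0} g" unfolding g_def by (intro continuous_intros)
      fix r assume r: "0 < r" "r < t0"
      then show "((\<lambda>r. S (t0 - r) (u r)) has_vector_derivative S (t0 - r) (B r (u r))) (at r)"
        using duhamel_has_vector_derivative[OF t0(1), of r] by (simp add: at_within_Icc_at)
      show "(g has_vector_derivative M * (b * (m * exp (l * r)))) (at r)"
        unfolding g_def has_real_derivative_iff_has_vector_derivative[symmetric]
        using l by (auto intro!: derivative_eq_intros)
      show "norm (S (t0 - r) (B r (u r))) \<le> M * (b * (m * exp (l * r)))"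
        using r t0(1) by (intro norm_S_apply norm_B_apply u_le) auto
    qed
  qed simp
  also have "\<dots> \<le> g t0" using nonneg \<open>0 \<le> m\<close> l by (simp add: g_def)
  also have "g t0 \<le> m / 2 * exp (l * t0)"
  proof -
    have "M * b / l \<le> 1 / 2" using l by (simp add: l_def field_simps)
    then have "M * b / l * (m * exp (l * t0)) \<le> 1 / 2 * (m * exp (l * t0))"
      using \<open>0 \<le> m\<close> by (intro mult_right_mono) auto
    then show ?thesis by (simp add: g_def mult_ac)
  qed
  finally have "norm (u t0 - S t0 u0) \<le> m / 2 * exp (l * t0)" by (simp add: u_0)
  moreover have "norm (S t0 u0) \<le> M * E"
    using t0(1) u0_le by (rule norm_S_apply)
  moreover have "norm (u t0) \<le> norm (u t0 - S t0 u0) + norm (S t0 u0)"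
    by (metis diff_add_cancel norm_triangle_ineq)
  ultimately have "norm (u t0) \<le> M * E + m / 2 * exp (l * t0)" by linarith
  also have "M * E \<le> M * E * exp (l * t0)"
    using nonneg l t0(1) mult_left_mono[of 1 "exp (l * t0)" "M * E"] by simp
  finally have "norm (u t0) \<le> (M * E + m / 2) * exp (l * t0)" by (simp add: algebra_simps)
  then have "m \<le> M * E + m / 2" by (simp add: m_def exp_minus field_simps)
  then have "m \<le> 2 * M * E" by simp
  have "norm (u t) \<le> m * exp (l * t)" using assms by (rule u_le)
  also have "\<dots> \<le> 2 * M * E * exp (l * H)"
    using \<open>m \<le> 2 * M * E\<close> \<open>0 \<le> m\<close> l assms h nonneg by (intro mult_mono) auto
  finally show ?thesis by (simp add: growth_def l_def mult_ac)
qed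

lemma u_minus_S:
  assumes t: "t \<in> {0..h}"
  shows "norm (u t - S t u0) \<le> M * (b * (growth H b M * E)) * t"
proof -
  have "norm (S (t - t) (u t) - S (t - 0) (u 0)) \<le> M * (b * (growth H b M * E)) * \<bar>t - 0\<bar>"
  proof (rule vector_derivative_bound[of 0 t])
    fix s assume s: "s \<in> {0..t}"
    then show "((\<lambda>s. S (t - s) (u s)) has_vector_derivative S (t - s) (B s (u s))) (at s within {0..t})"
      by (rule duhamel_has_vector_derivative[OF t])
    show "norm (S (t - s) (B s (u s))) \<le> M * (b * (growth H b M * E))"
      using s t by (intro norm_S_apply norm_B_apply norm_u) auto
  qed (use t in auto)
  then show ?thesis using t by (simp add: u_0)
qed

lemma sandwich_B_lipschitz:
  assumes a: "a \<in> {0..h}" and "s \<in> {0..a}" "t \<in> {0..a}"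
  shows "norm (S (a - s) (B s (S s u0)) - S (a - t) (B t (S t u0))) \<le> M * ((k + b1) * (M * E)) * \<bar>s - t\<bar>"
proof -
  have "norm (S (a - s) (B s (S s u0)) - S (a - t) (B t (S t u0)))
      \<le> M * ((k + b1) * (M * norm u0)) * \<bar>s - t\<bar>"
    using assms nonneg u0_D
    by (intro sandwich_lipschitz[where T' = B'] norm_comm_B B_D B'_le S_le
        has_vector_derivative_within_subset[OF B_deriv]) auto
  also have "\<dots> \<le> M * ((k + b1) * (M * E)) * \<bar>s - t\<bar>"
    using nonneg u0_le by (intro mult_mono order_refl) auto
  finally show ?thesis .
qed

definition G where "G s = S (h - s) (B s (B s (S s u0)))"

lemma G_lipschitz:
  assumes "s \<in> {0..h}" "t \<in> {0..h}"
  shows "norm (G s - G t) \<le> M * ((2 * b * k + 2 * b * b1) * (M * E)) * \<bar>s - t\<bar>"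
proof -
  have "norm (S (h - s) ((B s o\<^sub>L B s) (S s u0)) - S (h - t) ((B t o\<^sub>L B t) (S t u0)))
      \<le> M * ((2 * b * k + 2 * b * b1) * (M * norm u0)) * \<bar>s - t\<bar>"
  proof (rule sandwich_lipschitz)
    fix r assume r: "r \<in> {0..h}"
    show "((\<lambda>r. B r o\<^sub>L B r) has_vector_derivative ((B r o\<^sub>L B' r) + (B' r o\<^sub>L B r))) (at r within {0..h})"
      by (rule bounded_bilinear.has_vector_derivative[OF bounded_bilinear_blinfun_compose
            B_deriv[OF r] B_deriv[OF r]])
    have "norm ((B r o\<^sub>L B' r) + (B' r o\<^sub>L B r)) \<le> b * b1 + b1 * b"
      using r B_le B'_le nonneg
      by (intro norm_triangle_mono order_trans[OF norm_blinfun_compose] mult_mono) auto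
    then show "norm ((B r o\<^sub>L B' r) + (B' r o\<^sub>L B r)) \<le> 2 * b * b1" by simp
    fix x assume x: "x \<in> D"
    show "(B r o\<^sub>L B r) x \<in> D" using r x by (simp add: B_D)
    \<comment> \<open>The commutator with \<open>A\<close> is a derivation, so the square of
      \<open>B r\<close> inherits boundedness from \<open>B r\<close>.\<close>
    have "commutator A (B r o\<^sub>L B r) x = B r (commutator A (B r) x) + commutator A (B r) (B r x)"
      by (simp add: commutator_def blinfun.diff_right)
    moreover have "norm (B r (commutator A (B r) x)) \<le> b * (k * norm x)"
      by (intro norm_B_apply norm_comm_B r x)
    moreover have "norm (commutator A (B r) (B r x)) \<le> k * (b * norm x)"
      using norm_comm_B[OF r B_D[OF r x]] mult_left_mono[OF norm_B_apply[OF r order_refl, of x] nonneg(5)]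
      by linarith
    ultimately show "norm (commutator A (B r o\<^sub>L B r) x) \<le> (2 * b * k) * norm x"
      by (simp add: norm_triangle_le mult_ac)
  qed (use assms nonneg u0_D S_le in auto)
  also have "\<dots> \<le> M * ((2 * b * k + 2 * b * b1) * (M * E)) * \<bar>s - t\<bar>"
    using nonneg u0_le by (intro mult_mono order_refl) auto
  finally show ?thesis by (simp add: G_def)
qed

lemma u_second_order:
  assumes s: "s \<in> {0..h}"
  shows "norm (u s - S s u0 - s *\<^sub>R B s (S s u0)) \<le> h * (h * (duhamel_const H b b1 k M * E))"
proof -
  let ?c = "duhamel_const H b b1 k M"
  \<comment> \<open>\<open>z\<close> is the value at \<open>r = s\<close> of the sandwiched
    \<open>B\<close>, since \<open>S 0\<close> is the identity. Subtracting
    \<open>r *\<^sub>R z\<close> leaves a derivative of size \<open>O(h)\<close>, and the mean value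
    inequality contributes the second factor \<open>h\<close>.\<close>
  define z where "z = B s (S s u0)"
  have c_nonneg: "0 \<le> ?c * E"
    using nonneg by (simp add: duhamel_const_def growth_def)
  have "norm ((S (s - s) (u s) - s *\<^sub>R z) - (S (s - 0) (u 0) - 0 *\<^sub>R z)) \<le> h * (?c * E) * \<bar>s - 0\<bar>"
  proof (rule vector_derivative_bound[of 0 s])
    fix r assume r: "r \<in> {0..s}"
    then have rh: "r \<in> {0..h}" "s - r \<in> {0..h}" using s by auto
    show "((\<lambda>r. S (s - r) (u r) - r *\<^sub>R z) has_vector_derivative (S (s - r) (B r (u r)) - z)) (at r within {0..s})"
      by (rule derivative_eq_intros duhamel_has_vector_derivative[OF s r] refl)+ simp
    have "S (s - r) (B r (u r)) - z =
        S (s - r) (B r (u r - S r u0)) + (S (s - r) (B r (S r u0)) - S (s - s) (B s (S s u0)))"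
      by (simp add: z_def blinfun.diff_right)
    moreover have "norm (S (s - r) (B r (u r - S r u0))) \<le> M * (b * (M * (b * (growth H b M * E)) * r))"
      by (intro norm_S_apply norm_B_apply u_minus_S rh)
    moreover have "norm (S (s - r) (B r (S r u0)) - S (s - s) (B s (S s u0))) \<le>
        M * ((k + b1) * (M * E)) * \<bar>r - s\<bar>"
      using r s by (intro sandwich_B_lipschitz) auto
    ultimately have "norm (S (s - r) (B r (u r)) - z) \<le>
        M * (b * (M * (b * (growth H b M * E)) * r)) + M * ((k + b1) * (M * E)) * \<bar>r - s\<bar>"
      by (simp add: norm_triangle_mono)
    also have "\<dots> \<le> M * (b * (M * (b * (growth H b M * E)) * h)) + M * ((k + b1) * (M * E)) * h"
      using nonneg r s by (intro add_mono mult_left_mono) (auto simp: growth_def)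
    also have "\<dots> = h * (?c * E)"
      by (simp add: duhamel_const_def algebra_simps)
    finally show "norm (S (s - r) (B r (u r)) - z) \<le> h * (?c * E)" .
  qed (use s in auto)
  also have "\<dots> \<le> h * (?c * E) * h"
    using s h c_nonneg by (intro mult_left_mono) auto
  finally show ?thesis by (simp add: u_0 z_def mult.commute algebra_simps)
qed

text \<open>The correction terms are the integral over \<open>r \<in> {0..h}\<close> of the first-order expansion
  \<open>f s + (r - s) *\<^sub>R f' s + r *\<^sub>R G s\<close> of \<open>S (h - r) (B r (u r))\<close>.\<close>

lemma u_third_order:
  assumes s: "s \<in> {0..h}"
  shows "norm (u h - S h u0 - h *\<^sub>R f s - (h\<^sup>2 / 2 - h * s) *\<^sub>R f' s - (h\<^sup>2 / 2) *\<^sub>R G s)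
    \<le> h ^ 3 * (quadrature_const H b b1 b2 k M * E)"
proof -
  let ?c = "quadrature_const H b b1 b2 k M"
  \<comment> \<open>A primitive of the expansion is subtracted from the Duhamel flow. The derivative
    of \<open>q\<close> is then the pointwise error of the expansion, and its mean value bound takes
    the place of an integral.\<close>
  define q where "q r = S (h - r) (u r) - r *\<^sub>R f s - (r\<^sup>2 / 2 - r * s) *\<^sub>R f' s - (r\<^sup>2 / 2) *\<^sub>R G s" for r
  have hh: "h \<in> {0..h}" using h by simp
  have "norm (q h - q 0) \<le> h\<^sup>2 * (?c * E) * \<bar>h - 0\<bar>"
  proof (rule vector_derivative_bound[of 0 h])
    fix r assume r: "r \<in> {0..h}"
    have "((\<lambda>r. r\<^sup>2 / 2 - r * s) has_real_derivative r - s) (at r within {0..h})"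
      "((\<lambda>r. r\<^sup>2 / 2) has_real_derivative r) (at r within {0..h})"
      by (auto intro!: derivative_eq_intros)
    note scaled = this[THEN has_vector_derivative_scaleR, OF has_vector_derivative_const]
    show "(q has_vector_derivative (S (h - r) (B r (u r)) - f s - (r - s) *\<^sub>R f' s - r *\<^sub>R G s)) (at r within {0..h})"
      using has_vector_derivative_diff[OF has_vector_derivative_diff[OF has_vector_derivative_diff[OF
          duhamel_has_vector_derivative[OF hh r]
          has_vector_derivative_scaleR[OF DERIV_ident has_vector_derivative_const[of "f s"]]]
          scaled(1)[of "f' s"]] scaled(2)[of "G s"]]
      by (simp add: q_def[abs_def])
    have "S (h - r) (B r (u r)) - f s - (r - s) *\<^sub>R f' s - r *\<^sub>R G s =
        S (h - r) (B r (u r - S r u0 - r *\<^sub>R B r (S r u0))) + r *\<^sub>R (G r - G s)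
        + (f r - f s - (r - s) *\<^sub>R f' s)"
      by (simp add: f_def G_def blinfun.add_right blinfun.diff_right blinfun.scaleR_right algebra_simps)
    also have "norm \<dots> \<le> M * (b * (h * (h * (duhamel_const H b b1 k M * E))))
        + h * (M * ((2 * b * k + 2 * b * b1) * (M * E)) * h) + h\<^sup>2 * (M * (M * ((3 + b2 * M) * E)))"
    proof (intro norm_triangle_mono)
      show "norm (S (h - r) (B r (u r - S r u0 - r *\<^sub>R B r (S r u0))))
          \<le> M * (b * (h * (h * (duhamel_const H b b1 k M * E))))"
        using r by (intro norm_S_apply norm_B_apply u_second_order) auto
      have "norm (G r - G s) \<le> M * ((2 * b * k + 2 * b * b1) * (M * E)) * \<bar>r - s\<bar>"
        by (intro G_lipschitz r s)
      also have "\<dots> \<le> M * ((2 * b * k + 2 * b * b1) * (M * E)) * h"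
        using r s nonneg by (intro mult_left_mono) auto
      finally show "norm (r *\<^sub>R (G r - G s)) \<le> h * (M * ((2 * b * k + 2 * b * b1) * (M * E)) * h)"
        using r by (simp add: mult_mono)
      show "norm (f r - f s - (r - s) *\<^sub>R f' s) \<le> h\<^sup>2 * (M * (M * ((3 + b2 * M) * E)))"
        by (intro f_taylor r s)
    qed
    also have "\<dots> = h\<^sup>2 * (?c * E)"
      by (simp add: quadrature_const_def power2_eq_square algebra_simps)
    finally show "norm (S (h - r) (B r (u r)) - f s - (r - s) *\<^sub>R f' s - r *\<^sub>R G s) \<le> h\<^sup>2 * (?c * E)" .
  qed (use h in auto)
  moreover have "q h - q 0 = u h - S h u0 - h *\<^sub>R f s - (h\<^sup>2 / 2 - h * s) *\<^sub>R f' s - (h\<^sup>2 / 2) *\<^sub>R G s"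
    by (simp add: q_def u_0)
  ultimately show ?thesis
    using h by (simp add: power3_eq_cube power2_eq_square mult_ac)
qed

section \<open>Expansion of the scheme and comparison\<close>

text \<open>The exponent is \<open>P + Q\<close> with \<open>P\<close> of order \<open>h\<close> and
  \<open>Q\<close> of order \<open>h\<^sup>2\<close>. Hence its cube and every product in its square
  that contains \<open>Q\<close> are of order \<open>h ^ 3\<close>.\<close>

lemma exponential_expansion:
  assumes s: "s \<in> {0..h}" and c: "\<bar>c\<bar> \<le> 1 / 2"
  shows "norm (blinfun_exp (h *\<^sub>R B s + (h\<^sup>2 * c) *\<^sub>R C_op D A B B' s)
      - (id_blinfun + h *\<^sub>R B s + (h\<^sup>2 * c) *\<^sub>R C_op D A B B' s + (h\<^sup>2 / 2) *\<^sub>R (B s o\<^sub>L B s)))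
    \<le> h ^ 3 * exponential_const H b b1 k"
proof -
  define P where "P = h *\<^sub>R B s"
  define Q where "Q = (h\<^sup>2 * c) *\<^sub>R C_op D A B B' s"
  define \<kappa> where "\<kappa> = k + b1"
  \<comment> \<open>One of the two factors \<open>h\<close> in the bound for \<open>Q\<close> is
    estimated by \<open>H\<close>, which gives both parts of the exponent a common factor
    \<open>h\<close>.\<close>
  define \<beta> where "\<beta> = b + H * \<kappa> / 2"
  have \<kappa>: "0 \<le> \<kappa>" and \<beta>: "0 \<le> \<beta>" using nonneg h by (auto simp: \<kappa>_def \<beta>_def)
  have P: "norm P \<le> h * b" using h B_le[OF s] by (simp add: P_def)
  have Q: "norm Q \<le> h\<^sup>2 / 2 * \<kappa>"
  proof -
    have "norm (C_op D A B B' s) \<le> \<kappa>"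
      unfolding C_op_def \<kappa>_def using s by (intro norm_triangle_mono K_le B'_le)
    then have "h\<^sup>2 * \<bar>c\<bar> * norm (C_op D A B B' s) \<le> h\<^sup>2 * (1 / 2) * \<kappa>"
      using c by (intro mult_mono) auto
    then show ?thesis by (simp add: Q_def abs_mult)
  qed
  have PQ: "norm (P + Q) \<le> h * \<beta>"
  proof -
    have "h * (h * \<kappa>) \<le> h * (H * \<kappa>)"
      using h \<kappa> by (intro mult_left_mono mult_right_mono) auto
    then have "h * b + h\<^sup>2 / 2 * \<kappa> \<le> h * \<beta>"
      by (simp add: \<beta>_def power2_eq_square algebra_simps)
    then show ?thesis using norm_triangle_mono[OF P Q] by linarith
  qed
  have "norm (blinfun_exp (P + Q) - (id_blinfun + (P + Q) + (1/2) *\<^sub>R ((P + Q) o\<^sub>L (P + Q))))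
      \<le> norm (P + Q) ^ 3 * exp (norm (P + Q))"
    by (rule blinfun_exp_taylor2)
  also have "\<dots> \<le> (h * \<beta>) ^ 3 * exp (H * \<beta>)"
  proof (intro mult_mono power_mono PQ)
    have "h * \<beta> \<le> H * \<beta>" using h \<beta> by (intro mult_right_mono) auto
    then show "exp (norm (P + Q)) \<le> exp (H * \<beta>)" using PQ by simp
  qed (use h \<beta> in auto)
  finally have 1: "norm (blinfun_exp (P + Q) - (id_blinfun + (P + Q) + (1/2) *\<^sub>R ((P + Q) o\<^sub>L (P + Q))))
      \<le> h ^ 3 * (\<beta> ^ 3 * exp (H * \<beta>))"
    by (simp add: power_mult_distrib mult_ac)
  have "norm (((P + Q) o\<^sub>L Q) + (Q o\<^sub>L P)) \<le> (h * \<beta>) * (h\<^sup>2 / 2 * \<kappa>) + (h\<^sup>2 / 2 * \<kappa>) * (h * b)"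
    using P Q PQ h \<beta> \<kappa> nonneg
    by (intro norm_triangle_mono order_trans[OF norm_blinfun_compose] mult_mono) auto
  then have 2: "norm ((1/2) *\<^sub>R (((P + Q) o\<^sub>L Q) + (Q o\<^sub>L P))) \<le> h ^ 3 * (\<kappa> * (\<beta> + b) / 4)"
    unfolding norm_scaleR by (simp add: power2_eq_square power3_eq_cube algebra_simps)
  have "(P + Q) o\<^sub>L (P + Q) = (P o\<^sub>L P) + (((P + Q) o\<^sub>L Q) + (Q o\<^sub>L P))"
    by (rule blinfun_eqI) (simp add: blinfun.add_left blinfun.add_right)
  moreover have "P o\<^sub>L P = h\<^sup>2 *\<^sub>R (B s o\<^sub>L B s)"
    by (rule blinfun_eqI) (simp add: P_def blinfun.scaleR_left blinfun.scaleR_right power2_eq_square)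
  ultimately have eq: "blinfun_exp (P + Q) - (id_blinfun + P + Q + (h\<^sup>2 / 2) *\<^sub>R (B s o\<^sub>L B s)) =
      (blinfun_exp (P + Q) - (id_blinfun + (P + Q) + (1/2) *\<^sub>R ((P + Q) o\<^sub>L (P + Q))))
      + (1/2) *\<^sub>R (((P + Q) o\<^sub>L Q) + (Q o\<^sub>L P))"
    by (simp add: scaleR_add_right algebra_simps)
  have "norm (blinfun_exp (P + Q) - (id_blinfun + P + Q + (h\<^sup>2 / 2) *\<^sub>R (B s o\<^sub>L B s)))
      \<le> h ^ 3 * (\<beta> ^ 3 * exp (H * \<beta>)) + h ^ 3 * (\<kappa> * (\<beta> + b) / 4)"
    using norm_triangle_mono[OF 1 2] by (simp only: eq)
  then show ?thesis
    by (simp add: P_def Q_def exponential_const_def \<beta>_def[symmetric] \<kappa>_def[symmetric] Let_def distrib_left)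
qed

lemma error_bound:
  assumes "0 \<le> \<tau>" "\<tau> \<le> 1"
  shows "norm (u h - D_op D A S B B' h \<tau> u0)
    \<le> h ^ 3 * (quadrature_const H b b1 b2 k M + M * exponential_const H b b1 k * M) * E"
proof -
  define s where "s = h * \<tau>"
  define c where "c = (1 - 2 * \<tau>) / 2"
  have s: "s \<in> {0..h}" using h assms by (auto simp: s_def mult_left_le)
  have c: "\<bar>c\<bar> \<le> 1 / 2" using assms by (auto simp: c_def abs_le_iff)
  define X where "X = h *\<^sub>R B s + (h\<^sup>2 * c) *\<^sub>R C_op D A B B' s"
  define R where "R = blinfun_exp X
    - (id_blinfun + h *\<^sub>R B s + (h\<^sup>2 * c) *\<^sub>R C_op D A B B' s + (h\<^sup>2 / 2) *\<^sub>R (B s o\<^sub>L B s))"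
  have R: "norm R \<le> h ^ 3 * exponential_const H b b1 k"
    unfolding R_def X_def by (rule exponential_expansion[OF s c])
  have "D_op D A S B B' h \<tau> u0 = S (h - s) (blinfun_exp X (S s u0))"
    by (simp add: D_op_def X_def s_def c_def algebra_simps)
  also have "blinfun_exp X = R
    + (id_blinfun + h *\<^sub>R B s + (h\<^sup>2 * c) *\<^sub>R C_op D A B B' s + (h\<^sup>2 / 2) *\<^sub>R (B s o\<^sub>L B s))"
    by (simp add: R_def)
  also have "S (h - s) (\<dots> (S s u0)) = S (h - s) (R (S s u0)) + (S h u0 + h *\<^sub>R f s
      + (h\<^sup>2 * c) *\<^sub>R f' s + (h\<^sup>2 / 2) *\<^sub>R G s)"
    using S_add[of "h - s" s u0] s
    by (simp add: f_def f'_def G_def blinfun.add_left blinfun.add_right blinfun.scaleR_left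
        blinfun.scaleR_right)
  \<comment> \<open>With \<open>s = h * \<tau>\<close> the coefficient in the exponent equals the
    integral of \<open>r - s\<close> over \<open>{0..h}\<close>, so all terms up to order two agree
    with those of \<open>u_third_order\<close>.\<close>
  also have "h\<^sup>2 * c = h\<^sup>2 / 2 - h * s"
    by (simp add: c_def s_def power2_eq_square field_simps)
  finally have "u h - D_op D A S B B' h \<tau> u0 =
      (u h - S h u0 - h *\<^sub>R f s - (h\<^sup>2 / 2 - h * s) *\<^sub>R f' s - (h\<^sup>2 / 2) *\<^sub>R G s) - S (h - s) (R (S s u0))"
    by (simp add: algebra_simps)
  moreover have "norm (S (h - s) (R (S s u0))) \<le> M * (h ^ 3 * exponential_const H b b1 k * (M * E))"
  proof (rule norm_S_apply)
    show "norm (R (S s u0)) \<le> h ^ 3 * exponential_const H b b1 k * (M * E)"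
      by (rule order_trans[OF norm_blinfun mult_mono])
         (use R norm_S_apply[OF s u0_le] order_trans[OF norm_ge_zero R] in auto)
  qed (use s in auto)
  ultimately have "norm (u h - D_op D A S B B' h \<tau> u0) \<le>
      h ^ 3 * (quadrature_const H b b1 b2 k M * E) + M * (h ^ 3 * exponential_const H b b1 k * (M * E))"
    using u_third_order[OF s] norm_triangle_ineq4 by (smt (verit))
  then show ?thesis by (simp add: algebra_simps)
qed

end

section \<open>Suprema as uniform bounds\<close>

lemma norm_le_Y_norm:
  assumes "bdd_above ((\<lambda>s. norm (v s)) ` {0..h})" "s \<in> {0..h}"
  shows "norm (v s) \<le> Y_norm h v"
  unfolding Y_norm_def by (rule cSUP_upper[OF assms(2,1)])

lemma continuous_norm_le_Y_norm:
  assumes "continuous_on {0..h} v" "s \<in> {0..h}"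
  shows "norm (v s) \<le> Y_norm h v"
proof (rule norm_le_Y_norm)
  have "compact ((\<lambda>s. norm (v s)) ` {0..h})"
    by (intro compact_continuous_image continuous_intros assms compact_Icc)
  then show "bdd_above ((\<lambda>s. norm (v s)) ` {0..h})"
    by (rule bounded_imp_bdd_above[OF compact_imp_bounded])
qed fact

lemma C2_on_continuous:
  assumes "C2_on h v v' v''"
  shows "continuous_on {0..h} v" "continuous_on {0..h} v'" "continuous_on {0..h} v''"
  using assms unfolding C2_on_def continuous_on_eq_continuous_within
  by (blast intro: has_vector_derivative_continuous)+

text \<open>A real \<open>SUP\<close> dominates its members only over a set that is bounded above.
  For the entry with two independent times this follows from the bounds on the extended commutator
  and the semigroup; the values needed are then read off on the diagonal
  \<open>r = s\<close>.\<close>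

lemma (in generated_semigroup) error_max_upper:
  assumes comm: "\<And>s. s \<in> {0..h} \<Longrightarrow> bounded_commutator D A (B s)"
    and K: "bdd_above ((\<lambda>s. norm (commutator_ext D A (B s))) ` {0..h})"
    and comm_K: "bdd_above ((\<lambda>s. norm (commutator A (commutator_ext D A (B s)) (S s u0))) ` {0..h})"
    and comm_B': "bdd_above ((\<lambda>s. norm (commutator A (B' s) (S s u0))) ` {0..h})"
    and u0: "u0 \<in> D" and s: "s \<in> {0..h}"
  shows "norm (commutator A (commutator_ext D A (B s)) (S s u0)) \<le> error_max D A S B B' h u0"
    and "norm (commutator A (B' s) (S s u0)) \<le> error_max D A S B B' h u0"
    and "norm u0 \<le> error_max D A S B B' h u0"
proof -
  let ?e = "\<lambda>(r, s). Max {norm (commutator A (B s) (S r u0)), norm (commutator A (B' s) (S s u0)),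
    norm (commutator A (commutator_ext D A (B s)) (S s u0)), norm u0}"
  obtain k where k: "\<And>s. s \<in> {0..h} \<Longrightarrow> norm (commutator_ext D A (B s)) \<le> k"
    using K unfolding bdd_above_def by blast
  obtain M where M: "\<And>s. s \<in> {0..h} \<Longrightarrow> norm (S s) \<le> M"
    using S_bdd_above[of h] unfolding bdd_above_def by blast
  obtain c where c: "\<And>s. s \<in> {0..h} \<Longrightarrow> norm (commutator A (commutator_ext D A (B s)) (S s u0)) \<le> c"
    using comm_K unfolding bdd_above_def by blast
  obtain d where d: "\<And>s. s \<in> {0..h} \<Longrightarrow> norm (commutator A (B' s) (S s u0)) \<le> d"
    using comm_B' unfolding bdd_above_def by blast
  have nonneg: "0 \<le> k" "0 \<le> M" "0 \<le> c" "0 \<le> d"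
    using order_trans[OF norm_ge_zero k[OF s]] order_trans[OF norm_ge_zero M[OF s]]
      order_trans[OF norm_ge_zero c[OF s]] order_trans[OF norm_ge_zero d[OF s]] by auto
  have B_le: "norm (commutator A (B t) (S r u0)) \<le> k * (M * norm u0)" if "r \<in> {0..h}" "t \<in> {0..h}" for r t
  proof -
    have "S r u0 \<in> D" using that u0 by (intro S_in_D) auto
    then have "commutator A (B t) (S r u0) = commutator_ext D A (B t) (S r u0)"
      using comm[OF that(2)] by (simp add: commutator_ext_apply)
    moreover have "norm (S r u0) \<le> M * norm u0"
      using M[OF that(1)] by (intro order_trans[OF norm_blinfun] mult_right_mono) auto
    ultimately show ?thesis
      using order_trans[OF norm_blinfun mult_mono[OF k[OF that(2)]]] nonneg by simp
  qed
  have "bdd_above (?e ` ({0..h} \<times> {0..h}))"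
  proof (rule bdd_aboveI2)
    fix p assume p: "p \<in> {0..h} \<times> {0..h}"
    obtain r t where [simp]: "p = (r, t)" by (cases p)
    have "r \<in> {0..h}" "t \<in> {0..h}" using p by auto
    moreover define a where "a = k * (M * norm u0)"
    moreover have "0 \<le> a" using nonneg by (simp add: a_def)
    ultimately show "?e p \<le> k * (M * norm u0) + c + d + norm u0"
      using B_le[of r t] c[of t] d[of t] nonneg
      by (simp flip: a_def) (use norm_ge_zero[of u0] in linarith)
  qed
  then have "?e (s, s) \<le> error_max D A S B B' h u0"
    unfolding error_max_def using s by (intro cSUP_upper) auto
  then show "norm (commutator A (commutator_ext D A (B s)) (S s u0)) \<le> error_max D A S B B' h u0"
    and "norm (commutator A (B' s) (S s u0)) \<le> error_max D A S B B' h u0"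
    and "norm u0 \<le> error_max D A S B B' h u0"
    by auto
qed

theorem theorem3p2:
  fixes H :: real
  assumes "H > 0"
  shows "\<exists>C :: real \<Rightarrow> real \<Rightarrow> real \<Rightarrow> real \<Rightarrow> real \<Rightarrow> real \<Rightarrow> real.
    \<forall>(D :: 'a::banach set) (A :: 'a \<Rightarrow> 'a) (S :: real \<Rightarrow> 'a \<Rightarrow>\<^sub>L 'a)
      (B :: real \<Rightarrow> 'a \<Rightarrow>\<^sub>L 'a) (B' :: real \<Rightarrow> 'a \<Rightarrow>\<^sub>L 'a) (B'' :: real \<Rightarrow> 'a \<Rightarrow>\<^sub>L 'a)
      (u :: real \<Rightarrow> 'a) (u0 :: 'a) (h :: real) (\<tau> :: real).
      0 < h \<and> h \<le> H \<and> 0 \<le> \<tau> \<and> \<tau> \<le> 1 \<and>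
      densely_defined_closed_operator D A \<and>
      generates D A S \<and>
      C2_on h B B' B'' \<and>
      C1_solution D A B h u0 u \<and>
      (\<forall>s\<in>{0..h}. bounded_commutator D A (B s)) \<and>
      bdd_above ((\<lambda>s. norm (commutator_ext D A (B s))) ` {0..h}) \<and>
      (\<forall>s\<in>{0..h}. S s u0 \<in> commutator_domain D (commutator_ext D A (B s))) \<and>
      bdd_above ((\<lambda>s. norm (commutator A (commutator_ext D A (B s)) (S s u0))) ` {0..h}) \<and>
      (\<forall>s\<in>{0..h}. S s u0 \<in> commutator_domain D (B' s)) \<and>
      bdd_above ((\<lambda>s. norm (commutator A (B' s) (S s u0))) ` {0..h})
      \<longrightarrow>
      norm (u h - D_op D A S B B' h \<tau> u0)
        \<le> h ^ 3 * C \<tau> (Y_norm h B) (Y_norm h B'')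
                     (Y_norm h B') (Y_norm h (\<lambda>s. commutator_ext D A (B s))) (Y_norm h S)
            * error_max D A S B B' h u0"
proof (intro exI allI impI, elim conjE)
  fix D :: "'a set" and A :: "'a \<Rightarrow> 'a" and S B B' B'' :: "real \<Rightarrow> 'a \<Rightarrow>\<^sub>L 'a"
    and u :: "real \<Rightarrow> 'a" and u0 :: 'a and h \<tau> :: real
  assume h: "0 < h" "h \<le> H" and \<tau>: "0 \<le> \<tau>" "\<tau> \<le> 1"
    and op: "densely_defined_closed_operator D A" "generates D A S"
    and C2: "C2_on h B B' B''" and u: "C1_solution D A B h u0 u"
    and comm: "\<forall>s\<in>{0..h}. bounded_commutator D A (B s)"
    and K: "bdd_above ((\<lambda>s. norm (commutator_ext D A (B s))) ` {0..h})"
    and domain_K: "\<forall>s\<in>{0..h}. S s u0 \<in> commutator_domain D (commutator_ext D A (B s))"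
    and comm_K: "bdd_above ((\<lambda>s. norm (commutator A (commutator_ext D A (B s)) (S s u0))) ` {0..h})"
    and domain_B': "\<forall>s\<in>{0..h}. S s u0 \<in> commutator_domain D (B' s)"
    and comm_B': "bdd_above ((\<lambda>s. norm (commutator A (B' s) (S s u0))) ` {0..h})"
  interpret generated_semigroup D A S by unfold_locales fact+
  have u0: "u0 \<in> D" using u h by (auto simp: C1_solution_def)
  have comm': "bounded_commutator D A (B s)" if "s \<in> {0..h}" for s using comm that by blast
  note E = error_max_upper[OF comm' K comm_K comm_B' u0]
  interpret splitting D A S B B' B'' u u0 h H "error_max D A S B B' h u0" "Y_norm h B" "Y_norm h B'"
    "Y_norm h B''" "Y_norm h (\<lambda>s. commutator_ext D A (B s))" "Y_norm h S"
  proof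
    show "norm u0 \<le> error_max D A S B B' h u0" using E(3)[of 0] h by simp
    fix s assume s: "s \<in> {0..h}"
    show "norm (S s) \<le> Y_norm h S" by (rule norm_le_Y_norm[OF S_bdd_above s])
    show "norm (commutator_ext D A (B s)) \<le> Y_norm h (\<lambda>s. commutator_ext D A (B s))"
      by (rule norm_le_Y_norm[OF K s])
    show "norm (B s) \<le> Y_norm h B" "norm (B' s) \<le> Y_norm h B'" "norm (B'' s) \<le> Y_norm h B''"
      using C2_on_continuous[OF C2] s by (auto intro: continuous_norm_le_Y_norm)
  qed (use h C2 u comm domain_K domain_B' E in auto)
  \<comment> \<open>The abstraction instantiates the constant left schematic by \<open>exI\<close>.
    It may mention \<open>H\<close> but none of the data fixed afterwards, which reach it only as
    arguments.\<close>
  show "norm (u h - D_op D A S B B' h \<tau> u0) \<le> h ^ 3 *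
      (\<lambda>\<tau> b b2 b1 k M. quadrature_const H b b1 b2 k M + M * exponential_const H b b1 k * M)
        \<tau> (Y_norm h B) (Y_norm h B'') (Y_norm h B') (Y_norm h (\<lambda>s. commutator_ext D A (B s))) (Y_norm h S)
      * error_max D A S B B' h u0"
    using error_bound[OF \<tau>] by simp
qed

end
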